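(* Let $n$ be an odd positive integer, let $T>0$, $s>3/2$, and let $u\in C^0([0,T);H^s(\mathbb{R}))$ be a solution of $$u_t-u_{txx}+\frac{(n+1)(n+2)}{2}u^nu_x=\frac{n(n-1)}{2}u^{n-2}u_x^3+2n u^{n-1}u_xu_{xx}+u^n u_{xxx}.$$ Assume that there exists a non-empty open rectangle $\mathcal{R}=(t_0,t_1)\times(x_0,x_1)\subset[0,T)\times\mathbb{R}$ such that $u|_{\mathcal{R}}\equiv0$. Then $u\equiv0$.
   Context: Solutions: the equation is understood in the equivalent nonlocal form $$u_t+u^nu_x+\partial_x(1-\partial_x^2)^{-1}\left(\frac n2u^{n-1}u_x^2+\frac{n(n+3)}{2(n+1)}u^{n+1}\right)=0,$$ where $(1-\partial_x^2)^{-1}f=g*f$ with $g(x)=e^{-|x|}/2$. By a solution one means a real-valued $u\in C^0([0,T);H^s(\mathbb{R}))\cap C^1([0,T);H^{s-1}(\mathbb{R}))$, $s>3/2$, the unique solution of the Cauchy problem with $u(0,\cdot)=u_0\in H^s(\mathbb{R})$. For such solutions $\|u(t,\cdot)\|_{H^1(\mathbb{R})}$ is independent of $t$. *)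

theory Defs
  imports "HOL-Analysis.Analysis"
begin

section \<open>Sobolev spaces on the real line\<close>

definition square_integrable :: "(real \<Rightarrow> 'a::real_normed_vector) \<Rightarrow> bool" where
  "square_integrable f \<longleftrightarrow>
     f \<in> borel_measurable lborel \<and> integrable lborel (\<lambda>x. (norm (f x))\<^sup>2)"

text \<open>The Fourier transform with kernel \<open>exp (- \<i> \<xi> x)\<close>; meaningful for integrable functions.\<close>

definition fourier_integral :: "(real \<Rightarrow> complex) \<Rightarrow> real \<Rightarrow> complex" where
  "fourier_integral f \<xi> = (LINT x|lborel. cis (- (\<xi> * x)) * f x)"

text \<open>
  The Fourier--Plancherel transform of a square integrable function: the limit in the mean of the
  Fourier integrals of its truncations to \<open>[-R, R]\<close>, which are integrable. The transform is
  determined up to null sets. The distance is taken as an extended nonnegative integral, so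
  that convergence to \<open>0\<close> cannot hold through a divergent integral being assigned the value \<open>0\<close>.
\<close>

definition has_fourier_transform :: "(real \<Rightarrow> complex) \<Rightarrow> (real \<Rightarrow> complex) \<Rightarrow> bool" where
  "has_fourier_transform f \<phi> \<longleftrightarrow>
     square_integrable f \<and> square_integrable \<phi> \<and>
     ((\<lambda>R. \<integral>\<^sup>+ \<xi>. ennreal ((cmod (fourier_integral (\<lambda>x. indicator {-R..R} x *\<^sub>R f x) \<xi> - \<phi> \<xi>))\<^sup>2)
              \<partial>lborel) \<longlongrightarrow> 0) at_top"

definition fourier_transform :: "(real \<Rightarrow> complex) \<Rightarrow> real \<Rightarrow> complex" where
  "fourier_transform f = (SOME \<phi>. has_fourier_transform f \<phi>)"

text \<open>
  The real-valued elements of \<open>H\<^sup>s(\<real>)\<close>, for \<open>s \<ge> 0\<close> (for negative \<open>s\<close> the space also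
  contains distributions that are not functions). Its elements are functions, not
  classes modulo null sets: with a function, every Borel function equal to it almost everywhere is
  in the set as well.
\<close>

definition sobolev :: "real \<Rightarrow> (real \<Rightarrow> real) set" where
  "sobolev s = {f. \<exists>\<phi>. has_fourier_transform (\<lambda>x. complex_of_real (f x)) \<phi> \<and>
                       integrable lborel (\<lambda>\<xi>. (1 + \<xi>\<^sup>2) powr s * (cmod (\<phi> \<xi>))\<^sup>2)}"

text \<open>To be used for elements of \<open>sobolev s\<close> only; the factor \<open>1 / (2 * pi)\<close> makes
  \<open>sobolev_norm 0\<close> the usual \<open>L\<^sup>2\<close> norm.\<close>

definition sobolev_norm :: "real \<Rightarrow> (real \<Rightarrow> real) \<Rightarrow> real" where
  "sobolev_norm s f =
     sqrt (1 / (2 * pi) *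
       (LINT \<xi>|lborel. (1 + \<xi>\<^sup>2) powr s *
          (cmod (fourier_transform (\<lambda>x. complex_of_real (f x)) \<xi>))\<^sup>2))"


section \<open>Curves in Sobolev spaces\<close>

text \<open>\<open>u \<in> C\<^sup>0([0,T); H\<^sup>s(\<real>))\<close>, where \<open>u t\<close> stands for \<open>u(t, \<cdot>)\<close>.\<close>

definition C0_sobolev :: "real \<Rightarrow> real \<Rightarrow> (real \<Rightarrow> real \<Rightarrow> real) \<Rightarrow> bool" where
  "C0_sobolev T s u \<longleftrightarrow>
     (\<forall>t\<in>{0..<T}. u t \<in> sobolev s) \<and>
     (\<forall>t\<in>{0..<T}. ((\<lambda>\<tau>. sobolev_norm s (\<lambda>x. u \<tau> x - u t x)) \<longlongrightarrow> 0) (at t within {0..<T}))"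

text \<open>\<open>u \<in> C\<^sup>1([0,T); H\<^sup>s(\<real>))\<close> with derivative \<open>v\<close>; the derivative is one-sided at \<open>0\<close>.\<close>

definition C1_sobolev_with_derivative ::
    "real \<Rightarrow> real \<Rightarrow> (real \<Rightarrow> real \<Rightarrow> real) \<Rightarrow> (real \<Rightarrow> real \<Rightarrow> real) \<Rightarrow> bool" where
  "C1_sobolev_with_derivative T s u v \<longleftrightarrow>
     C0_sobolev T s u \<and> C0_sobolev T s v \<and>
     (\<forall>t\<in>{0..<T}. ((\<lambda>\<tau>. sobolev_norm s (\<lambda>x. (u \<tau> x - u t x) / (\<tau> - t) - v t x)) \<longlongrightarrow> 0)
        (at t within {0..<T}))"


section \<open>The equation\<close>

text \<open>\<open>(1 - \<partial>\<^sub>x\<^sup>2)\<^sup>-\<^sup>1 f = g * f\<close> with \<open>g(x) = exp (- \<bar>x\<bar>) / 2\<close>.\<close>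

definition inv_helmholtz :: "(real \<Rightarrow> real) \<Rightarrow> real \<Rightarrow> real" where
  "inv_helmholtz f x = (LINT y|lborel. exp (- \<bar>x - y\<bar>) / 2 * f y)"

definition nonlocal_source :: "nat \<Rightarrow> (real \<Rightarrow> real) \<Rightarrow> real \<Rightarrow> real" where
  "nonlocal_source n w x =
     real n / 2 * w x ^ (n - 1) * (deriv w x)\<^sup>2 +
     real n * (real n + 3) / (2 * (real n + 1)) * w x ^ (n + 1)"

text \<open>
  A solution of
  \<open>u\<^sub>t - u\<^sub>t\<^sub>x\<^sub>x + (n+1)(n+2)/2 u\<^sup>n u\<^sub>x
     = n(n-1)/2 u\<^sup>n\<^sup>-\<^sup>2 u\<^sub>x\<^sup>3 + 2n u\<^sup>n\<^sup>-\<^sup>1 u\<^sub>x u\<^sub>x\<^sub>x + u\<^sup>n u\<^sub>x\<^sub>x\<^sub>x\<close>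
  in \<open>C\<^sup>0([0,T); H\<^sup>s(\<real>)) \<inter> C\<^sup>1([0,T); H\<^sup>s\<^sup>-\<^sup>1(\<real>))\<close>, \<open>s > 3/2\<close>, in the nonlocal form obtained by
  applying \<open>(1 - \<partial>\<^sub>x\<^sup>2)\<^sup>-\<^sup>1\<close>. Each \<open>u t\<close> is taken to be the continuous
  representative of its class in \<open>H\<^sup>s(\<real>)\<close>. As \<open>s > 3/2\<close>, this representative is
  continuously differentiable, so that \<open>deriv\<close> is the derivative in \<open>x\<close> of the equation. The equation
  is an identity in \<open>H\<^sup>s\<^sup>-\<^sup>1(\<real>)\<close>, that is, almost everywhere in \<open>x\<close> for every \<open>t\<close>.
\<close>

definition is_solution :: "nat \<Rightarrow> real \<Rightarrow> real \<Rightarrow> (real \<Rightarrow> real \<Rightarrow> real) \<Rightarrow> bool" where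
  "is_solution n s T u \<longleftrightarrow>
     (\<forall>t\<in>{0..<T}. continuous_on UNIV (u t)) \<and>
     C0_sobolev T s u \<and>
     (\<exists>v. C1_sobolev_with_derivative T (s - 1) u v \<and>
       (\<forall>t\<in>{0..<T}. AE x in lborel.
          v t x + u t x ^ n * deriv (u t) x
            + deriv (inv_helmholtz (nonlocal_source n (u t))) x = 0))"

end

theory Submission
  imports Defs "HOL-Probability.Characteristic_Functions" "HOL-Real_Asymp.Real_Asymp"
begin

text \<open>
  Fourier inversion turns a solution in \<open>H\<^sup>s\<close>, \<open>s > 3/2\<close>, into a classical one: \<open>t \<mapsto> u(t)\<close> is continuous
  with values in the bounded \<open>C\<^sup>1\<close> functions, and \<open>u\<^sub>t + u\<^sup>n u\<^sub>x + F\<^sub>x = 0\<close> holds pointwise, with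
  \<open>F = g * f\<close> and \<open>f\<close> the nonlocal source.

  On the rectangle \<open>u\<close>, \<open>u\<^sub>x\<close>, \<open>u\<^sub>t\<close> and \<open>f\<close> vanish, so \<open>F\<^sub>x = 0\<close> there, and then
  \<open>F = F\<^sub>x\<^sub>x + f = 0\<close>. For odd \<open>n\<close> the source is nonnegative, and \<open>F\<close> is its convolution with a positive
  kernel, so \<open>f = 0\<close> on the whole line, which forces \<open>u(t) = 0\<close> for the times of the rectangle.

  Instead of using conservation of the \<open>H\<^sup>1\<close> norm, vanishing is propagated in time by a maximum principle.
  Near a time at which \<open>u\<close> vanishes, if \<open>u\<close> and \<open>u\<^sub>x\<close> are bounded by \<open>m \<le> 1\<close>, then \<open>u\<close> and its spatial
  difference quotients solve transport equations with source \<open>O(m)\<close>, so on a short time interval of a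
  length independent of \<open>m\<close> they are bounded by \<open>m / 2\<close>. Hence the set of times at which \<open>u\<close> vanishes is
  open, and it is closed.
\<close>

section \<open>Fourier inversion\<close>

text \<open>The obstacle is low regularity. Membership in \<open>sobolev\<close> speaks of an L2
  limit known up to null sets, and the equation holds almost everywhere in x at each time, while the
  argument evaluates u, u_x and u_t at points. For s just above 3/2 no second x-derivative is at
  hand, and an energy identity for the H1 norm would need integrations by parts that such a solution
  does not directly support; sup bounds avoid them. The time step does not depend on m because, for
  sizes m \<le> 1, every source term is at most a constant times m, and F_x is Lipschitz in x with a
  constant of the same kind, its derivative being F - f. Starting from 0, a bound K * t with K
  proportional to m is at most m / 2 on a step determined by n, and repeating the argument on that
  same step gives the bound (1/2)^k for every k. The estimate uses only the absolute value of the
  velocity and of the source, so it also runs backward in time. This is what reaches the times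
  before the rectangle.\<close>

lemma borel_measurable_cis [measurable]: "cis \<in> borel_measurable borel"
  by (intro borel_measurable_continuous_onI continuous_intros)

text \<open>This is the characteristic function of the standard normal law, rescaled by
  \<open>s\<close>. The right-hand side is written as \<open>2 * pi\<close> times the normal density
  of standard deviation \<open>1 / s\<close>, the form in which it acts as an approximate identity
  in \<open>gaussian_mean_tendsto\<close>.\<close>

lemma gaussian_fourier_integral:
  fixes s z :: real
  assumes "s > 0"
  shows "(LINT \<xi>|lborel. cis (z * \<xi>) * complex_of_real (exp (- (\<xi> / s)\<^sup>2 / 2))) =
         complex_of_real (2 * pi * (s * std_normal_density (s * z)))"
proof -
  have "(LINT \<xi>|lborel. std_normal_density \<xi> *\<^sub>R cis (s * z * \<xi>)) = complex_of_real (exp (- (s * z)\<^sup>2 / 2))"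
  proof -
    have "char std_normal_distribution (s * z) = (LINT \<xi>|lborel. std_normal_density \<xi> *\<^sub>R cis (s * z * \<xi>))"
      unfolding char_def by (subst integral_density) (auto simp: cis_conv_exp)
    then show ?thesis
      by (simp add: char_std_normal_distribution)
  qed
  also have "(LINT \<xi>|lborel. std_normal_density \<xi> *\<^sub>R cis (s * z * \<xi>)) =
      (1 / s) *\<^sub>R (LINT \<xi>|lborel. std_normal_density (\<xi> / s) *\<^sub>R cis (z * \<xi>))"
    using assms
    by (subst lborel_integral_real_affine[of "1 / s" _ 0]) (auto simp: field_simps)
  also have "(LINT \<xi>|lborel. std_normal_density (\<xi> / s) *\<^sub>R cis (z * \<xi>)) =
      (1 / sqrt (2 * pi)) *\<^sub>R (LINT \<xi>|lborel. cis (z * \<xi>) * complex_of_real (exp (- (\<xi> / s)\<^sup>2 / 2)))"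
    unfolding integral_scaleR_right[symmetric]
    by (rule Bochner_Integration.integral_cong) (auto simp: std_normal_density_def scaleR_conv_of_real)
  finally have "(LINT \<xi>|lborel. cis (z * \<xi>) * complex_of_real (exp (- (\<xi> / s)\<^sup>2 / 2))) =
      complex_of_real (s * sqrt (2 * pi) * exp (- (s * z)\<^sup>2 / 2))"
    using assms by (simp add: scaleR_conv_of_real field_simps)
  also have "s * sqrt (2 * pi) * exp (- (s * z)\<^sup>2 / 2) = 2 * pi * (s * std_normal_density (s * z))"
  proof -
    have "sqrt (2 * pi) * sqrt (2 * pi) = 2 * pi" by simp
    then have "sqrt (2 * pi) = 2 * pi / sqrt (2 * pi)" by (simp add: field_simps)
    then show ?thesis
      by (metis (no_types, lifting) std_normal_density_def times_divide_eq_left mult.assoc mult.commute mult.left_commute mult_1)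
  qed
  finally show ?thesis .
qed

lemma integrable_gaussian:
  fixes s :: real
  assumes "s > 0"
  shows "integrable lborel (\<lambda>\<xi>. exp (- (\<xi> / s)\<^sup>2 / 2))"
proof -
  have "integrable lborel (\<lambda>\<xi>. sqrt (2 * pi) * std_normal_density (0 + (1 / s) * \<xi>))"
    using assms by (intro integrable_mult_right lborel_integrable_real_affine) auto
  then show ?thesis by (simp add: std_normal_density_def)
qed

text \<open>With \<open>norm (f y)\<close> for \<open>x\<close>, this dominates a square integrable
  function by \<open>1\<close> plus its square, which is enough for integrability against a bounded
  integrable weight.\<close>

lemma le_one_plus_square: "(x::real) \<le> 1 + x\<^sup>2"
  using zero_le_power2[of "x - 1/2"] by (simp add: power2_eq_square algebra_simps)

lemma square_integrable_imp_set_integrable: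
  fixes f :: "real \<Rightarrow> 'a::{banach, second_countable_topology}"
  assumes "square_integrable f"
  shows "integrable lborel (\<lambda>x. indicator {a..b} x *\<^sub>R f x)"
proof -
  have [measurable]: "f \<in> borel_measurable lborel" and i: "integrable lborel (\<lambda>x. (norm (f x))\<^sup>2)"
    using assms by (auto simp: square_integrable_def)
  have "integrable lborel (\<lambda>x. indicator {a..b} x + (norm (f x))\<^sup>2)"
    using i by (intro Bochner_Integration.integrable_add integrable_real_indicator) (auto simp: emeasure_lborel_Icc_eq)
  then show ?thesis
  proof (rule Bochner_Integration.integrable_bound, measurable, intro AE_I2)
    fix x
    have "norm (f x) \<le> 1 + (norm (f x))\<^sup>2"
      by (rule le_one_plus_square)
    then show "norm (indicator {a..b} x *\<^sub>R f x) \<le> norm (indicator {a..b} x + (norm (f x))\<^sup>2)"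
      by (auto simp: indicator_def)
  qed
qed

text \<open>Fubini moves the Fourier kernel from \<open>f\<close> onto the Gaussian; the damping
  factor is what makes the double integral absolutely convergent.\<close>

lemma fourier_integral_gaussian:
  fixes f :: "real \<Rightarrow> complex" and s x :: real
  assumes f: "integrable lborel f" and s: "s > 0"
  shows "(LINT \<xi>|lborel. (cis (x * \<xi>) * complex_of_real (exp (- (\<xi> / s)\<^sup>2 / 2))) * fourier_integral f \<xi>) =
         2 * pi * (LINT y|lborel. (s * std_normal_density (s * (x - y))) *\<^sub>R f y)"
proof -
  let ?k = "\<lambda>\<xi>. complex_of_real (exp (- (\<xi> / s)\<^sup>2 / 2))"
  have [measurable]: "f \<in> borel_measurable borel" using f by auto
  let ?h = "\<lambda>\<xi> y. (cis (x * \<xi>) * ?k \<xi>) * (cis (- (\<xi> * y)) * f y)"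
  have int: "integrable (lborel \<Otimes>\<^sub>M lborel) (case_prod ?h)"
  proof (rule lborel_pair.Fubini_integrable)
    show "case_prod ?h \<in> borel_measurable (lborel \<Otimes>\<^sub>M lborel)" by measurable
    have "(\<lambda>\<xi>. LINT y|lborel. norm (case_prod ?h (\<xi>, y))) = (\<lambda>\<xi>. exp (- (\<xi> / s)\<^sup>2 / 2) * (LINT y|lborel. norm (f y)))"
      by (simp add: norm_mult)
    then show "integrable lborel (\<lambda>\<xi>. LINT y|lborel. norm (case_prod ?h (\<xi>, y)))"
      using integrable_gaussian[OF s] by simp
    have "integrable lborel (\<lambda>y. cis (- (\<xi> * y)) * f y)" for \<xi>
      by (rule Bochner_Integration.integrable_bound[OF f]) (auto simp: norm_mult)
    then show "AE \<xi> in lborel. integrable lborel (\<lambda>y. case_prod ?h (\<xi>, y))"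
      by auto
  qed
  have "(LINT \<xi>|lborel. (cis (x * \<xi>) * ?k \<xi>) * fourier_integral f \<xi>) = (LINT \<xi>|lborel. LINT y|lborel. ?h \<xi> y)"
    by (simp add: fourier_integral_def)
  also have "\<dots> = (LINT y|lborel. LINT \<xi>|lborel. ?h \<xi> y)"
    using lborel_pair.Fubini_integral[OF int] by simp
  also have "\<dots> = (LINT y|lborel. f y * (LINT \<xi>|lborel. cis ((x - y) * \<xi>) * ?k \<xi>))"
    unfolding integral_mult_right_zero[symmetric]
    by (intro Bochner_Integration.integral_cong refl)
       (simp add: cis_mult[symmetric] algebra_simps cis_mult)
  also have "\<dots> = (LINT y|lborel. complex_of_real (2 * pi) * ((s * std_normal_density (s * (x - y))) *\<^sub>R f y))"
    by (intro Bochner_Integration.integral_cong refl)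
       (simp only: gaussian_fourier_integral[OF s], simp add: scaleR_conv_of_real)
  also have "\<dots> = 2 * pi * (LINT y|lborel. (s * std_normal_density (s * (x - y))) *\<^sub>R f y)"
    by (subst integral_mult_right_zero) simp
  finally show ?thesis .
qed

text \<open>The integral of \<open>(l * f x - g x)\<^sup>2\<close> is a nonnegative quadratic in
  \<open>l\<close>, so its discriminant is not positive.\<close>

lemma integral_cauchy_schwarz:
  fixes f g :: "'a \<Rightarrow> real"
  assumes [measurable]: "f \<in> borel_measurable M" "g \<in> borel_measurable M"
    and f: "integrable M (\<lambda>x. (f x)\<^sup>2)" and g: "integrable M (\<lambda>x. (g x)\<^sup>2)"
  shows "integrable M (\<lambda>x. f x * g x)"
    and "(LINT x|M. f x * g x)\<^sup>2 \<le> (LINT x|M. (f x)\<^sup>2) * (LINT x|M. (g x)\<^sup>2)"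
proof -
  show fg: "integrable M (\<lambda>x. f x * g x)"
  proof (rule Bochner_Integration.integrable_bound)
    show "integrable M (\<lambda>x. (f x)\<^sup>2 + (g x)\<^sup>2)" using f g by simp
    have "\<bar>a * b\<bar> \<le> a\<^sup>2 + b\<^sup>2" for a b :: real
      using sum_squares_bound[of "\<bar>a\<bar>" "\<bar>b\<bar>"] mult_nonneg_nonneg[of "\<bar>a\<bar>" "\<bar>b\<bar>"]
      unfolding abs_mult power2_abs by linarith
    then show "AE x in M. norm (f x * g x) \<le> norm ((f x)\<^sup>2 + (g x)\<^sup>2)" by auto
  qed measurable
  define A B C where "A = (LINT x|M. (f x)\<^sup>2)" and "B = (LINT x|M. f x * g x)" and "C = (LINT x|M. (g x)\<^sup>2)"
  have quad: "0 \<le> l\<^sup>2 * A - 2 * l * B + C" for l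
  proof -
    have "0 \<le> (LINT x|M. (l * f x - g x)\<^sup>2)" by simp
    also have "\<dots> = (LINT x|M. l\<^sup>2 * (f x)\<^sup>2 - 2 * l * (f x * g x) + (g x)\<^sup>2)"
      by (intro Bochner_Integration.integral_cong refl) (simp add: power2_eq_square algebra_simps)
    also have "\<dots> = l\<^sup>2 * A - 2 * l * B + C"
      unfolding A_def B_def C_def using f g fg by simp
    finally show ?thesis .
  qed
  have A0: "A \<ge> 0" by (simp add: A_def)
  have "B\<^sup>2 \<le> A * C"
  proof (cases "A = 0")
    case True
    have "B = 0"
    proof (rule ccontr)
      assume "B \<noteq> 0"
      \<comment> \<open>For \<open>A = 0\<close> the quadratic is affine in \<open>l\<close>, and
        \<open>l = (C + 1) / (2 * B)\<close> would give it the value \<open>- 1\<close>.\<close>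
      then have "2 * ((C + 1) / (2 * B)) * B = C + 1" by (simp add: field_simps)
      with quad[of "(C + 1) / (2 * B)"] True show False by simp
    qed
    with True show ?thesis by simp
  next
    case False
    with A0 have "A > 0" by simp
    have "0 \<le> A * ((B / A)\<^sup>2 * A - 2 * (B / A) * B + C)"
      using quad[of "B / A"] A0 by simp
    also have "\<dots> = A * C - B\<^sup>2"
      using \<open>A > 0\<close> by (simp add: field_simps power2_eq_square)
    finally show ?thesis by simp
  qed
  then show "(LINT x|M. f x * g x)\<^sup>2 \<le> (LINT x|M. (f x)\<^sup>2) * (LINT x|M. (g x)\<^sup>2)"
    by (simp add: A_def B_def C_def)
qed

lemma std_normal_density_le_one: "std_normal_density z \<le> 1"
proof -
  have "1 \<le> sqrt (2 * pi)" using pi_gt3 by (intro real_le_rsqrt) simp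
  moreover have "exp (- z\<^sup>2 / 2) \<le> 1" by simp
  ultimately show ?thesis
    unfolding std_normal_density_def using mult_mono[of "1 / sqrt (2 * pi)" 1 "exp (- z\<^sup>2 / 2)" 1] by simp
qed

lemma integrable_std_normal_affine:
  fixes s x :: real assumes "s > 0"
  shows "integrable lborel (\<lambda>y. s * std_normal_density (s * (x - y)))"
proof -
  have "integrable lborel (\<lambda>y. s * std_normal_density (s * x + (- s) * y))"
    using assms by (intro integrable_mult_right lborel_integrable_real_affine) auto
  then show ?thesis by (simp add: algebra_simps)
qed

lemma integrable_gaussian_mult:
  fixes f :: "real \<Rightarrow> complex" and s x :: real
  assumes f: "square_integrable f" and s: "s > 0"
  shows "integrable lborel (\<lambda>y. (s * std_normal_density (s * (x - y))) *\<^sub>R f y)"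
proof -
  have [measurable]: "f \<in> borel_measurable borel" and i: "integrable lborel (\<lambda>x. (norm (f x))\<^sup>2)"
    using f by (auto simp: square_integrable_def)
  have "integrable lborel (\<lambda>y. s * std_normal_density (s * (x - y)) + s * (norm (f y))\<^sup>2)"
    using i integrable_std_normal_affine[OF s] by (intro Bochner_Integration.integrable_add) auto
  then show ?thesis
  proof (rule Bochner_Integration.integrable_bound, measurable, intro AE_I2)
    fix y
    let ?g = "std_normal_density (s * (x - y))"
    have "?g * norm (f y) \<le> ?g * (1 + (norm (f y))\<^sup>2)"
      by (intro mult_left_mono le_one_plus_square) auto
    also have "\<dots> \<le> ?g + (norm (f y))\<^sup>2"
      using mult_right_mono[OF std_normal_density_le_one, of "(norm (f y))\<^sup>2" "s * (x - y)"] by (simp add: algebra_simps)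
    finally have "s * (?g * norm (f y)) \<le> s * (?g + (norm (f y))\<^sup>2)"
      using s by (intro mult_left_mono) auto
    then show "norm ((s * ?g) *\<^sub>R f y) \<le> norm (s * ?g + s * (norm (f y))\<^sup>2)"
      using s by (simp add: abs_mult algebra_simps)
  qed
qed

lemma integral_gaussian_rescale:
  fixes g :: "real \<Rightarrow> 'a::{banach, second_countable_topology}" and s x :: real
  assumes s: "s > 0"
  shows "(LINT y|lborel. (s * std_normal_density (s * (x - y))) *\<^sub>R g y) =
         (LINT z|lborel. std_normal_density z *\<^sub>R g (x - z / s))"
proof -
  have "(LINT y|lborel. (s * std_normal_density (s * (x - y))) *\<^sub>R g y) =
     \<bar>- (1 / s)\<bar> *\<^sub>R (LINT z|lborel. (s * std_normal_density (s * (x - (x + (- (1 / s)) * z)))) *\<^sub>R g (x + (- (1 / s)) * z))"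
    using s by (intro lborel_integral_real_affine) auto
  also have "\<dots> = \<bar>- (1 / s)\<bar> *\<^sub>R (LINT z|lborel. s *\<^sub>R (std_normal_density z *\<^sub>R g (x - z / s)))"
  proof -
    have *: "x + (- (1 / s)) * z = x - z / s" "s * (x - (x - z / s)) = z" for z
      using s by (simp_all add: field_simps)
    show ?thesis unfolding * scaleR_scaleR ..
  qed
  also have "\<dots> = (LINT z|lborel. std_normal_density z *\<^sub>R g (x - z / s))"
    using s by (subst integral_scaleR_right) simp
  finally show ?thesis .
qed

text \<open>A continuous \<open>f\<close> may be unbounded, so it is cut at distance
  \<open>1\<close> from \<open>x\<close>. The near part is bounded, and dominated convergence
  applies once the Gaussian is rescaled to a fixed one. The far part is controlled by the mass of
  the Gaussian outside the cut and by the square integral of \<open>f\<close> times the kernel at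
  distance \<open>1\<close>; both vanish in the limit.\<close>

lemma gaussian_mean_tendsto:
  fixes f :: "real \<Rightarrow> complex"
  assumes f: "square_integrable f" and cont: "continuous_on UNIV f"
  shows "(\<lambda>n. LINT y|lborel. (real (Suc n) * std_normal_density (real (Suc n) * (x - y))) *\<^sub>R f y)
           \<longlonglongrightarrow> f x"
proof -
  have [measurable]: "f \<in> borel_measurable borel" and i: "integrable lborel (\<lambda>x. (norm (f x))\<^sup>2)"
    using f by (auto simp: square_integrable_def)
  define s where "s n = real (Suc n)" for n
  have s0: "s n > 0" for n by (simp add: s_def)
  have s1: "s n \<ge> 1" for n by (simp add: s_def)
  have s_top: "filterlim s at_top sequentially"
    unfolding s_def by (rule filterlim_compose[OF filterlim_real_sequentially filterlim_Suc])
  define G where "G n y = s n * std_normal_density (s n * (x - y))" for n y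
  have [measurable]: "G n \<in> borel_measurable borel" for n by (simp add: G_def[abs_def])
  have G0: "G n y \<ge> 0" for n y using s0[of n] by (simp add: G_def)
  define A where "A = {x - 1..x + 1}"
  have [measurable]: "A \<in> sets borel" by (simp add: A_def)
  define f1 f2 where "f1 = (\<lambda>y. indicator A y *\<^sub>R f y)" and "f2 = (\<lambda>y. indicator (- A) y *\<^sub>R f y)"
  have [measurable]: "f1 \<in> borel_measurable borel" "f2 \<in> borel_measurable borel"
    by (simp_all add: f1_def f2_def)
  have "compact (f ` A)"
    unfolding A_def by (intro compact_continuous_image continuous_on_subset[OF cont]) auto
  then obtain B where B: "\<And>y. y \<in> A \<Longrightarrow> norm (f y) \<le> B"
    using compact_imp_bounded bounded_iff by (metis imageI)
  have B0: "0 \<le> B" using order_trans[OF norm_ge_zero B[of x]] by (simp add: A_def)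
  have fB: "norm (f1 y) \<le> B" for y
    using B B0 by (auto simp: f1_def indicator_def)
  have near: "(\<lambda>n. LINT y|lborel. G n y *\<^sub>R f1 y) \<longlonglongrightarrow> f x"
  proof -
    have "(\<lambda>n. LINT z|lborel. std_normal_density z *\<^sub>R f1 (x - z / s n)) \<longlonglongrightarrow>
          (LINT z|lborel. std_normal_density z *\<^sub>R f x)"
    proof (rule integral_dominated_convergence[where w = "\<lambda>z. std_normal_density z * B"])
      show "AE z in lborel. (\<lambda>n. std_normal_density z *\<^sub>R f1 (x - z / s n)) \<longlonglongrightarrow> std_normal_density z *\<^sub>R f x"
      proof (intro AE_I2 tendsto_scaleR tendsto_const)
        fix z :: real
        have lim: "(\<lambda>n. z / s n) \<longlonglongrightarrow> 0"
          by (rule real_tendsto_divide_at_top[OF tendsto_const s_top])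
        then have l1: "(\<lambda>n. x - z / s n) \<longlonglongrightarrow> x" using tendsto_diff[OF tendsto_const[of x] lim] by simp
        have "isCont f x" using cont by (simp add: continuous_on_eq_continuous_at)
        then have l2: "(\<lambda>n. f (x - z / s n)) \<longlonglongrightarrow> f x" using l1 by (rule isCont_tendsto_compose)
        have "eventually (\<lambda>n. dist (z / s n) 0 < 1) sequentially"
          using lim by (rule tendstoD) simp
        then have "eventually (\<lambda>n. f (x - z / s n) = f1 (x - z / s n)) sequentially"
          by eventually_elim (auto simp: f1_def A_def indicator_def dist_real_def abs_less_iff simp del: abs_divide)
        then show "(\<lambda>n. f1 (x - z / s n)) \<longlonglongrightarrow> f x"
          using l2 by (rule Lim_transform_eventually[rotated])
      qed
      show "AE z in lborel. norm (std_normal_density z *\<^sub>R f1 (x - z / s n)) \<le> std_normal_density z * B" for n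
        using fB by (intro AE_I2) (auto intro!: mult_left_mono)
    qed (auto intro!: integrable_mult_left)
    also have "(LINT z|lborel. std_normal_density z *\<^sub>R f x) = f x"
      by (subst integral_scaleR_left) auto
    finally show ?thesis
      unfolding G_def by (subst integral_gaussian_rescale[OF s0])
  qed
  have far: "(\<lambda>n. LINT y|lborel. G n y *\<^sub>R f2 y) \<longlonglongrightarrow> 0"
  proof (rule tendsto_norm_zero_cancel, rule tendsto_sandwich[OF _ _ tendsto_const])
    define N where "N = (LINT y|lborel. (norm (f y))\<^sup>2)"
    define T where "T n = (LINT z|lborel. std_normal_density z *\<^sub>R indicat_real (- A) (x - z / s n))" for n
    show "eventually (\<lambda>n. 0 \<le> norm (LINT y|lborel. G n y *\<^sub>R f2 y)) sequentially" by simp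
    \<comment> \<open>Off \<open>A\<close> the kernel is at most its value at distance
      \<open>1\<close>. Bounding \<open>norm (f y)\<close> by
      \<open>1 + (norm (f y))\<^sup>2\<close> leaves the kernel mass \<open>T n\<close> from the
      \<open>1\<close> and this value times \<open>N\<close> from the square.\<close>
    have "norm (LINT y|lborel. G n y *\<^sub>R f2 y) \<le> T n + s n * std_normal_density (s n) * N" for n
    proof -
      have iG: "integrable lborel (\<lambda>y. G n y *\<^sub>R indicat_real (- A) y)"
        by (rule Bochner_Integration.integrable_bound[OF integrable_std_normal_affine[OF s0, of n x]])
           (auto simp: G_def indicator_def)
      have iN: "integrable lborel (\<lambda>y. s n * std_normal_density (s n) * (norm (f y))\<^sup>2)"
        using i by simp
      have "norm (LINT y|lborel. G n y *\<^sub>R f2 y) \<le>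
            (LINT y|lborel. G n y *\<^sub>R indicat_real (- A) y + s n * std_normal_density (s n) * (norm (f y))\<^sup>2)"
      proof (rule Bochner_Integration.integral_norm_bound_integral)
        show "integrable lborel (\<lambda>y. G n y *\<^sub>R f2 y)"
          by (rule Bochner_Integration.integrable_bound[OF integrable_gaussian_mult[OF f s0, of n x]])
             (auto simp: G_def f2_def indicator_def)
        show "integrable lborel (\<lambda>y. G n y *\<^sub>R indicat_real (- A) y + s n * std_normal_density (s n) * (norm (f y))\<^sup>2)"
          using iG iN by (rule Bochner_Integration.integrable_add)
        fix y
        show "norm (G n y *\<^sub>R f2 y) \<le> G n y *\<^sub>R indicat_real (- A) y + s n * std_normal_density (s n) * (norm (f y))\<^sup>2"
        proof (cases "y \<in> A")
          case True
          then show ?thesis using s0[of n] by (simp add: f2_def)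
        next
          case False
          then have "\<bar>x - y\<bar> \<ge> 1" by (auto simp: A_def)
          then have "(s n * 1)\<^sup>2 \<le> (s n * (x - y))\<^sup>2"
            using s0[of n] by (subst abs_le_square_iff[symmetric]) (simp add: abs_mult)
          then have "G n y \<le> s n * std_normal_density (s n)"
            using s0[of n] unfolding G_def std_normal_density_def by (simp add: divide_right_mono)
          then have "G n y * (norm (f y))\<^sup>2 \<le> s n * std_normal_density (s n) * (norm (f y))\<^sup>2"
            by (rule mult_right_mono) simp
          moreover have "G n y * norm (f y) \<le> G n y * (1 + (norm (f y))\<^sup>2)"
            by (intro mult_left_mono le_one_plus_square G0)
          ultimately show ?thesis
            using False G0[of n y] by (simp add: f2_def algebra_simps)
        qed
      qed
      also have "\<dots> = (LINT y|lborel. G n y *\<^sub>R indicat_real (- A) y) + s n * std_normal_density (s n) * N"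
        unfolding N_def using iG iN i by (subst Bochner_Integration.integral_add) auto
      also have "(LINT y|lborel. G n y *\<^sub>R indicat_real (- A) y) = T n"
        unfolding G_def T_def by (rule integral_gaussian_rescale[OF s0])
      finally show ?thesis .
    qed
    then show "eventually (\<lambda>n. norm (LINT y|lborel. G n y *\<^sub>R f2 y) \<le> T n + s n * std_normal_density (s n) * N) sequentially"
      by simp
    have "T \<longlonglongrightarrow> (LINT z|(lborel :: real measure). 0)"
      unfolding T_def[abs_def]
    proof (rule integral_dominated_convergence[where w = std_normal_density])
      show "AE z in lborel. (\<lambda>n. std_normal_density z *\<^sub>R indicat_real (- A) (x - z / s n)) \<longlonglongrightarrow> 0"
      proof (intro AE_I2)
        fix z :: real
        have lim: "(\<lambda>n. z / s n) \<longlonglongrightarrow> 0"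
          by (rule real_tendsto_divide_at_top[OF tendsto_const s_top])
        have "eventually (\<lambda>n. dist (z / s n) 0 < 1) sequentially"
          using lim by (rule tendstoD) simp
        then have "eventually (\<lambda>n. std_normal_density z *\<^sub>R indicat_real (- A) (x - z / s n) = 0) sequentially"
          by eventually_elim (auto simp: A_def indicator_def dist_real_def abs_less_iff simp del: abs_divide)
        then show "(\<lambda>n. std_normal_density z *\<^sub>R indicat_real (- A) (x - z / s n)) \<longlonglongrightarrow> 0"
          by (rule tendsto_eventually)
      qed
      show "AE z in lborel. norm (std_normal_density z *\<^sub>R indicat_real (- A) (x - z / s n)) \<le> std_normal_density z" for n
        by (intro AE_I2) (auto simp: indicator_def)
    qed auto
    moreover have "(\<lambda>n. s n * std_normal_density (s n)) \<longlonglongrightarrow> 0"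
    proof -
      have "((\<lambda>t::real. t * (1 / sqrt (2 * pi) * exp (- t\<^sup>2 / 2))) \<longlongrightarrow> 0) at_top" by real_asymp
      then show ?thesis unfolding std_normal_density_def by (rule filterlim_compose[OF _ s_top])
    qed
    ultimately have "(\<lambda>n. T n + (s n * std_normal_density (s n)) * N) \<longlonglongrightarrow> (LINT z|(lborel :: real measure). 0) + 0 * N"
      by (intro tendsto_add tendsto_mult tendsto_const)
    then show "(\<lambda>n. T n + s n * std_normal_density (s n) * N) \<longlonglongrightarrow> 0" by simp
  qed
  have "(LINT y|lborel. G n y *\<^sub>R f y) = (LINT y|lborel. G n y *\<^sub>R f1 y) + (LINT y|lborel. G n y *\<^sub>R f2 y)" for n
  proof -
    have "integrable lborel (\<lambda>y. G n y *\<^sub>R f1 y)" "integrable lborel (\<lambda>y. G n y *\<^sub>R f2 y)"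
      by (rule Bochner_Integration.integrable_bound[OF integrable_gaussian_mult[OF f s0, of n x]];
          auto simp: G_def f1_def f2_def indicator_def)+
    then have "(LINT y|lborel. G n y *\<^sub>R f1 y) + (LINT y|lborel. G n y *\<^sub>R f2 y) = (LINT y|lborel. G n y *\<^sub>R f1 y + G n y *\<^sub>R f2 y)"
      by simp
    also have "\<dots> = (LINT y|lborel. G n y *\<^sub>R f y)"
      by (intro Bochner_Integration.integral_cong refl) (auto simp: f1_def f2_def indicator_def)
    finally show ?thesis by simp
  qed
  then show ?thesis
    using tendsto_add[OF near far] by (simp add: G_def s_def)
qed

lemma borel_measurable_fourier_integral [measurable]:
  assumes [measurable]: "f \<in> borel_measurable borel"
  shows "fourier_integral f \<in> borel_measurable borel"
  unfolding fourier_integral_def[abs_def] by measurable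

lemma norm_fourier_integral_le: "norm (fourier_integral f \<xi>) \<le> (LINT x|lborel. norm (f x))"
  unfolding fourier_integral_def
  using integral_norm_bound[of lborel "\<lambda>x. cis (- (\<xi> * x)) * f x"] by (simp add: norm_mult)

text \<open>The transform is only a limit in the mean of the transforms of truncations, so it is
  first paired with a Gaussian of width \<open>s\<close>. In \<open>damped\<close> the truncation is
  removed, by Cauchy-Schwarz on the transform side and by domination on the side of
  \<open>f\<close>. Letting \<open>s\<close> grow then removes the damping: integrability of
  \<open>\<phi>\<close> gives the limit of one side, continuity of \<open>f\<close> that of the
  other.\<close>

theorem fourier_inversion:
  fixes f \<phi> :: "real \<Rightarrow> complex"
  assumes ft: "has_fourier_transform f \<phi>" and \<phi>: "integrable lborel \<phi>"
    and cont: "continuous_on UNIV f"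
  shows "f x = 1 / (2 * pi) * (LINT \<xi>|lborel. cis (x * \<xi>) * \<phi> \<xi>)"
proof -
  have f: "square_integrable f" and \<phi>2: "square_integrable \<phi>"
    and ft_lim: "((\<lambda>R. \<integral>\<^sup>+ \<xi>. ennreal ((cmod (fourier_integral (\<lambda>x. indicator {-R..R} x *\<^sub>R f x) \<xi> - \<phi> \<xi>))\<^sup>2)
              \<partial>lborel) \<longlongrightarrow> 0) at_top"
    using ft by (auto simp: has_fourier_transform_def)
  have [measurable]: "f \<in> borel_measurable borel" "\<phi> \<in> borel_measurable borel"
    using f \<phi>2 by (auto simp: square_integrable_def)
  define F where "F m = (\<lambda>y. indicator {- real m..real m} y *\<^sub>R f y)" for m :: nat
  have F_int: "integrable lborel (F m)" for m
    unfolding F_def by (rule square_integrable_imp_set_integrable[OF f])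
  have [measurable]: "F m \<in> borel_measurable borel" for m by (simp add: F_def)
  have "((\<lambda>m. \<integral>\<^sup>+ \<xi>. ennreal ((cmod (fourier_integral (F m) \<xi> - \<phi> \<xi>))\<^sup>2) \<partial>lborel) \<longlongrightarrow> 0) sequentially"
    unfolding F_def by (rule filterlim_compose[OF ft_lim filterlim_real_sequentially])
  then have L2: "(\<lambda>m. \<integral>\<^sup>+ \<xi>. ennreal ((cmod (fourier_integral (F m) \<xi> - \<phi> \<xi>))\<^sup>2) \<partial>lborel) \<longlonglongrightarrow> ennreal 0" by simp
  have damped: "(LINT \<xi>|lborel. (cis (x * \<xi>) * complex_of_real (exp (- (\<xi> / s)\<^sup>2 / 2))) * \<phi> \<xi>) =
      2 * pi * (LINT y|lborel. (s * std_normal_density (s * (x - y))) *\<^sub>R f y)" if s: "s > 0" for s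
  proof (rule LIMSEQ_unique)
    define k where "k \<xi> = exp (- (\<xi> / s)\<^sup>2 / 2)" for \<xi>
    have [measurable]: "k \<in> borel_measurable borel" by (simp add: k_def[abs_def])
    have k_int: "integrable lborel k" using integrable_gaussian[OF s] by (simp add: k_def[abs_def])
    have k1: "0 \<le> k \<xi>" "k \<xi> \<le> 1" for \<xi> by (auto simp: k_def)
    have k2_int: "integrable lborel (\<lambda>\<xi>. (k \<xi>)\<^sup>2)"
      by (rule Bochner_Integration.integrable_bound[OF k_int])
         (use k1 in \<open>auto simp: power2_eq_square mult_left_le\<close>)
    define K where "K = (LINT \<xi>|lborel. (k \<xi>)\<^sup>2)"
    have \<phi>k_int: "integrable lborel (\<lambda>\<xi>. (cis (x * \<xi>) * complex_of_real (k \<xi>)) * \<phi> \<xi>)"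
      by (rule Bochner_Integration.integrable_bound[OF \<phi>])
         (use k1 in \<open>auto simp: norm_mult mult_left_le_one_le\<close>)
    have Fk_int: "integrable lborel (\<lambda>\<xi>. (cis (x * \<xi>) * complex_of_real (k \<xi>)) * fourier_integral (F m) \<xi>)" for m
    proof (rule Bochner_Integration.integrable_bound)
      show "integrable lborel (\<lambda>\<xi>. k \<xi> * (LINT x|lborel. norm (F m x)))" using k_int by simp
      show "AE \<xi> in lborel. norm (cis (x * \<xi>) * complex_of_real (k \<xi>) * fourier_integral (F m) \<xi>) \<le>
              norm (k \<xi> * (LINT x|lborel. norm (F m x)))"
        using k1 norm_fourier_integral_le by (auto simp: norm_mult abs_mult intro!: mult_left_mono)
    qed measurable
    show "(\<lambda>m. LINT \<xi>|lborel. (cis (x * \<xi>) * complex_of_real (exp (- (\<xi> / s)\<^sup>2 / 2))) * fourier_integral (F m) \<xi>)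
      \<longlonglongrightarrow> (LINT \<xi>|lborel. (cis (x * \<xi>) * complex_of_real (exp (- (\<xi> / s)\<^sup>2 / 2))) * \<phi> \<xi>)"
      unfolding k_def[symmetric]
    proof (rule LIM_zero_cancel, rule tendsto_norm_zero_cancel, rule tendsto_sandwich[OF _ _ tendsto_const])
      let ?D = "\<lambda>m. (LINT \<xi>|lborel. (cis (x * \<xi>) * complex_of_real (k \<xi>)) * fourier_integral (F m) \<xi>) -
        (LINT \<xi>|lborel. (cis (x * \<xi>) * complex_of_real (k \<xi>)) * \<phi> \<xi>)"
      let ?a = "\<lambda>m. enn2real (\<integral>\<^sup>+ \<xi>. ennreal ((cmod (fourier_integral (F m) \<xi> - \<phi> \<xi>))\<^sup>2) \<partial>lborel)"
      show "eventually (\<lambda>m. 0 \<le> norm (?D m)) sequentially" by simp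
      \<comment> \<open>An extended integral tending to \<open>0\<close> is eventually finite. Only
        then is the squared error integrable and \<open>enn2real\<close> of the extended integral
        equal to its Bochner integral.\<close>
      have "eventually (\<lambda>m. (\<integral>\<^sup>+ \<xi>. ennreal ((cmod (fourier_integral (F m) \<xi> - \<phi> \<xi>))\<^sup>2) \<partial>lborel) < ennreal 1) sequentially"
        using L2 by (rule order_tendstoD) simp
      then show "eventually (\<lambda>m. norm (?D m) \<le> sqrt (K * ?a m)) sequentially"
      proof eventually_elim
        case (elim m)
        let ?d = "\<lambda>\<xi>. cmod (fourier_integral (F m) \<xi> - \<phi> \<xi>)"
        have d_int: "integrable lborel (\<lambda>\<xi>. (?d \<xi>)\<^sup>2)"
          using elim by (intro integrableI_bounded) (auto simp: less_top[symmetric] elim: less_trans)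
        have a: "?a m = (LINT \<xi>|lborel. (?d \<xi>)\<^sup>2)"
          using nn_integral_eq_integral[OF d_int] by simp
        have "norm (?D m) = norm (LINT \<xi>|lborel. (cis (x * \<xi>) * complex_of_real (k \<xi>)) * (fourier_integral (F m) \<xi> - \<phi> \<xi>))"
          by (simp only: right_diff_distrib Bochner_Integration.integral_diff[OF Fk_int \<phi>k_int])
        also have "\<dots> \<le> (LINT \<xi>|lborel. norm ((cis (x * \<xi>) * complex_of_real (k \<xi>)) * (fourier_integral (F m) \<xi> - \<phi> \<xi>)))"
          by (rule integral_norm_bound)
        also have "\<dots> = (LINT \<xi>|lborel. k \<xi> * ?d \<xi>)"
          using k1 by (simp add: norm_mult)
        also have "\<dots> \<le> sqrt (K * ?a m)"
          using integral_cauchy_schwarz(2)[of k lborel ?d] k2_int d_int unfolding a K_def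
          by (intro real_le_rsqrt) simp
        finally show ?case .
      qed
      have "?a \<longlonglongrightarrow> 0" by (rule tendsto_enn2real[OF L2]) simp
      then have "(\<lambda>m. sqrt (K * ?a m)) \<longlonglongrightarrow> sqrt (K * 0)"
        by (intro tendsto_real_sqrt tendsto_mult tendsto_const)
      then show "(\<lambda>m. sqrt (K * ?a m)) \<longlonglongrightarrow> 0" by simp
    qed
    show "(\<lambda>m. LINT \<xi>|lborel. (cis (x * \<xi>) * complex_of_real (exp (- (\<xi> / s)\<^sup>2 / 2))) * fourier_integral (F m) \<xi>)
      \<longlonglongrightarrow> 2 * pi * (LINT y|lborel. (s * std_normal_density (s * (x - y))) *\<^sub>R f y)"
      unfolding fourier_integral_gaussian[OF F_int s]
    proof (intro tendsto_mult tendsto_const integral_dominated_convergence[where w = "\<lambda>y. norm ((s * std_normal_density (s * (x - y))) *\<^sub>R f y)"])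
      show "integrable lborel (\<lambda>y. norm ((s * std_normal_density (s * (x - y))) *\<^sub>R f y))"
        using integrable_gaussian_mult[OF f s] by (rule integrable_norm)
      show "AE y in lborel. (\<lambda>m. (s * std_normal_density (s * (x - y))) *\<^sub>R F m y) \<longlonglongrightarrow> (s * std_normal_density (s * (x - y))) *\<^sub>R f y"
      proof (intro AE_I2 tendsto_scaleR tendsto_const)
        fix y :: real
        have "eventually (\<lambda>m. \<bar>y\<bar> \<le> real m) sequentially"
          using filterlim_real_sequentially by (simp add: filterlim_at_top)
        then have "eventually (\<lambda>m. F m y = f y) sequentially"
          by eventually_elim (auto simp: F_def indicator_def abs_le_iff)
        then show "(\<lambda>m. F m y) \<longlonglongrightarrow> f y" by (rule tendsto_eventually)
      qed
      show "AE y in lborel. norm ((s * std_normal_density (s * (x - y))) *\<^sub>R F m y) \<le> norm ((s * std_normal_density (s * (x - y))) *\<^sub>R f y)" for m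
        by (intro AE_I2) (auto simp: F_def indicator_def)
    qed measurable
  qed
  have "(\<lambda>n. LINT \<xi>|lborel. (cis (x * \<xi>) * complex_of_real (exp (- (\<xi> / real (Suc n))\<^sup>2 / 2))) * \<phi> \<xi>)
      \<longlonglongrightarrow> (LINT \<xi>|lborel. cis (x * \<xi>) * \<phi> \<xi>)"
  proof (rule integral_dominated_convergence[where w = "\<lambda>\<xi>. norm (\<phi> \<xi>)"])
    show "integrable lborel (\<lambda>\<xi>. norm (\<phi> \<xi>))" using \<phi> by simp
    show "AE \<xi> in lborel. norm ((cis (x * \<xi>) * complex_of_real (exp (- (\<xi> / real (Suc n))\<^sup>2 / 2))) * \<phi> \<xi>) \<le> norm (\<phi> \<xi>)" for n
      by (intro AE_I2) (simp add: norm_mult mult_left_le_one_le)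
    show "AE \<xi> in lborel. (\<lambda>n. (cis (x * \<xi>) * complex_of_real (exp (- (\<xi> / real (Suc n))\<^sup>2 / 2))) * \<phi> \<xi>)
            \<longlonglongrightarrow> cis (x * \<xi>) * \<phi> \<xi>"
    proof (intro AE_I2)
      fix \<xi> :: real
      have "(\<lambda>n. \<xi> / real (Suc n)) \<longlonglongrightarrow> 0"
        by (rule LIMSEQ_Suc[OF lim_const_over_n])
      moreover have "isCont (\<lambda>t::real. exp (- t\<^sup>2 / 2)) 0" by (intro continuous_intros) simp
      ultimately have "(\<lambda>n. exp (- (\<xi> / real (Suc n))\<^sup>2 / 2)) \<longlonglongrightarrow> exp (- 0\<^sup>2 / 2)"
        by (rule isCont_tendsto_compose[rotated])
      then have "(\<lambda>n. exp (- (\<xi> / real (Suc n))\<^sup>2 / 2)) \<longlonglongrightarrow> 1" by simp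
      then have "(\<lambda>n. complex_of_real (exp (- (\<xi> / real (Suc n))\<^sup>2 / 2))) \<longlonglongrightarrow> complex_of_real 1"
        by (rule tendsto_of_real)
      from tendsto_mult[OF tendsto_mult[OF tendsto_const[of "cis (x * \<xi>)"] this] tendsto_const[of "\<phi> \<xi>"]]
      show "(\<lambda>n. (cis (x * \<xi>) * complex_of_real (exp (- (\<xi> / real (Suc n))\<^sup>2 / 2))) * \<phi> \<xi>)
            \<longlonglongrightarrow> cis (x * \<xi>) * \<phi> \<xi>" by simp
    qed
  qed measurable
  moreover have "(\<lambda>n. LINT \<xi>|lborel. (cis (x * \<xi>) * complex_of_real (exp (- (\<xi> / real (Suc n))\<^sup>2 / 2))) * \<phi> \<xi>)
      \<longlonglongrightarrow> 2 * pi * f x"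
  proof -
    have "(LINT \<xi>|lborel. (cis (x * \<xi>) * complex_of_real (exp (- (\<xi> / real (Suc n))\<^sup>2 / 2))) * \<phi> \<xi>) =
      2 * pi * (LINT y|lborel. (real (Suc n) * std_normal_density (real (Suc n) * (x - y))) *\<^sub>R f y)" for n
      by (rule damped) simp
    then show ?thesis
      by (simp only:) (intro tendsto_mult tendsto_const gaussian_mean_tendsto[OF f cont])
  qed
  ultimately have "(LINT \<xi>|lborel. cis (x * \<xi>) * \<phi> \<xi>) = 2 * pi * f x"
    by (rule LIMSEQ_unique)
  then show ?thesis by simp
qed

lemma cmod_le_of_fourier_transform:
  assumes "has_fourier_transform f \<phi>" "integrable lborel \<phi>" "continuous_on UNIV f"
  shows "cmod (f x) \<le> (LINT \<xi>|lborel. cmod (\<phi> \<xi>))"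
proof -
  have "cmod (f x) = 1 / (2 * pi) * cmod (LINT \<xi>|lborel. cis (x * \<xi>) * \<phi> \<xi>)"
    by (subst fourier_inversion[OF assms]) (simp add: norm_mult norm_divide)
  also have "\<dots> \<le> 1 * (LINT \<xi>|lborel. cmod (\<phi> \<xi>))"
    using integral_norm_bound[of lborel "\<lambda>\<xi>. cis (x * \<xi>) * \<phi> \<xi>"] pi_gt3
    by (intro mult_mono) (auto simp: norm_mult)
  finally show ?thesis by simp
qed

section \<open>Sobolev embedding\<close>

lemma cmod_lincomb_square_le:
  "(cmod (a * x + b * y))\<^sup>2 \<le> 2 * (cmod a)\<^sup>2 * (cmod x)\<^sup>2 + 2 * (cmod b)\<^sup>2 * (cmod y)\<^sup>2"
proof -
  have "(cmod (a * x + b * y))\<^sup>2 \<le> (cmod a * cmod x + cmod b * cmod y)\<^sup>2"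
    using norm_triangle_ineq[of "a * x" "b * y"] by (intro power_mono) (auto simp: norm_mult)
  also have "\<dots> \<le> 2 * (cmod a * cmod x)\<^sup>2 + 2 * (cmod b * cmod y)\<^sup>2"
    using sum_squares_bound[of "cmod a * cmod x" "cmod b * cmod y"] by (simp add: power2_sum)
  finally show ?thesis by (simp add: power_mult_distrib)
qed

lemma square_integrable_lincomb:
  fixes f g :: "real \<Rightarrow> complex"
  assumes "square_integrable f" "square_integrable g"
  shows "square_integrable (\<lambda>x. a * f x + b * g x)"
proof -
  have [measurable]: "f \<in> borel_measurable borel" "g \<in> borel_measurable borel"
    using assms by (auto simp: square_integrable_def)
  have "integrable lborel (\<lambda>x. (norm (a * f x + b * g x))\<^sup>2)"
  proof (rule Bochner_Integration.integrable_bound)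
    show "integrable lborel (\<lambda>x. 2 * (cmod a)\<^sup>2 * (cmod (f x))\<^sup>2 + 2 * (cmod b)\<^sup>2 * (cmod (g x))\<^sup>2)"
      using assms by (intro Bochner_Integration.integrable_add integrable_mult_right) (auto simp: square_integrable_def)
  qed (use cmod_lincomb_square_le in auto)
  then show ?thesis by (simp add: square_integrable_def)
qed

lemma fourier_integral_lincomb:
  assumes f: "integrable lborel f" and g: "integrable lborel g"
  shows "fourier_integral (\<lambda>x. a * f x + b * g x) \<xi> = a * fourier_integral f \<xi> + b * fourier_integral g \<xi>"
proof -
  have *: "integrable lborel (\<lambda>x. cis (- (\<xi> * x)) * h x)" if h: "integrable lborel h" for h
  proof -
    have [measurable]: "h \<in> borel_measurable borel" using h by auto
    show ?thesis by (rule Bochner_Integration.integrable_bound[OF h]) (auto simp: norm_mult)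
  qed
  have "fourier_integral (\<lambda>x. a * f x + b * g x) \<xi> =
      (LINT x|lborel. a * (cis (- (\<xi> * x)) * f x) + b * (cis (- (\<xi> * x)) * g x))"
    unfolding fourier_integral_def by (intro Bochner_Integration.integral_cong refl) (simp add: algebra_simps)
  also have "\<dots> = a * fourier_integral f \<xi> + b * fourier_integral g \<xi>"
    unfolding fourier_integral_def using *[OF f] *[OF g] by simp
  finally show ?thesis .
qed

text \<open>Linearity is exact for each truncation, which is integrable. The squared error of the
  combination is at most a weighted sum of the two squared errors, so no Minkowski inequality for
  extended integrals enters.\<close>

lemma has_fourier_transform_lincomb:
  assumes f: "has_fourier_transform f \<phi>" and g: "has_fourier_transform g \<gamma>"
  shows "has_fourier_transform (\<lambda>x. a * f x + b * g x) (\<lambda>\<xi>. a * \<phi> \<xi> + b * \<gamma> \<xi>)"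
proof -
  have sq: "square_integrable f" "square_integrable g" "square_integrable \<phi>" "square_integrable \<gamma>"
    using f g by (auto simp: has_fourier_transform_def)
  then have [measurable]: "f \<in> borel_measurable borel" "g \<in> borel_measurable borel"
      "\<phi> \<in> borel_measurable borel" "\<gamma> \<in> borel_measurable borel"
    by (auto simp: square_integrable_def)
  let ?t = "\<lambda>R (h :: real \<Rightarrow> complex) x. indicator {-R..R} x *\<^sub>R h x"
  let ?E = "\<lambda>h \<eta> (R::real). \<integral>\<^sup>+ \<xi>. ennreal ((cmod (fourier_integral (?t R h) \<xi> - \<eta> \<xi>))\<^sup>2) \<partial>lborel"
  let ?h = "\<lambda>x. a * f x + b * g x" and ?\<eta> = "\<lambda>\<xi>. a * \<phi> \<xi> + b * \<gamma> \<xi>"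
  have "(?E ?h ?\<eta> \<longlongrightarrow> 0) at_top"
  proof (rule tendsto_sandwich[OF _ _ tendsto_const])
    show "eventually (\<lambda>R. 0 \<le> ?E ?h ?\<eta> R) at_top" by simp
    have "?E ?h ?\<eta> R \<le> ennreal (2 * (cmod a)\<^sup>2) * ?E f \<phi> R + ennreal (2 * (cmod b)\<^sup>2) * ?E g \<gamma> R" for R
    proof -
      have "?t R ?h = (\<lambda>x. a * ?t R f x + b * ?t R g x)"
        by (auto simp: fun_eq_iff indicator_def)
      then have lin: "fourier_integral (?t R ?h) \<xi> = a * fourier_integral (?t R f) \<xi> + b * fourier_integral (?t R g) \<xi>" for \<xi>
        using fourier_integral_lincomb[OF square_integrable_imp_set_integrable[OF sq(1)] square_integrable_imp_set_integrable[OF sq(2)]] by simp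
      have "?E ?h ?\<eta> R \<le> (\<integral>\<^sup>+ \<xi>. ennreal (2 * (cmod a)\<^sup>2) * ennreal ((cmod (fourier_integral (?t R f) \<xi> - \<phi> \<xi>))\<^sup>2)
            + ennreal (2 * (cmod b)\<^sup>2) * ennreal ((cmod (fourier_integral (?t R g) \<xi> - \<gamma> \<xi>))\<^sup>2) \<partial>lborel)"
      proof (rule nn_integral_mono)
        fix \<xi>
        have "fourier_integral (?t R ?h) \<xi> - ?\<eta> \<xi> = a * (fourier_integral (?t R f) \<xi> - \<phi> \<xi>) + b * (fourier_integral (?t R g) \<xi> - \<gamma> \<xi>)"
          unfolding lin by (simp add: algebra_simps)
        then show "ennreal ((cmod (fourier_integral (?t R ?h) \<xi> - ?\<eta> \<xi>))\<^sup>2) \<le>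
            ennreal (2 * (cmod a)\<^sup>2) * ennreal ((cmod (fourier_integral (?t R f) \<xi> - \<phi> \<xi>))\<^sup>2)
            + ennreal (2 * (cmod b)\<^sup>2) * ennreal ((cmod (fourier_integral (?t R g) \<xi> - \<gamma> \<xi>))\<^sup>2)"
          using cmod_lincomb_square_le[of a "fourier_integral (?t R f) \<xi> - \<phi> \<xi>" b "fourier_integral (?t R g) \<xi> - \<gamma> \<xi>"]
          by (simp add: ennreal_mult'[symmetric] ennreal_plus[symmetric] del: ennreal_plus)
      qed
      also have "\<dots> = ennreal (2 * (cmod a)\<^sup>2) * ?E f \<phi> R + ennreal (2 * (cmod b)\<^sup>2) * ?E g \<gamma> R"
        by (subst nn_integral_add) (simp_all add: nn_integral_cmult)
      finally show ?thesis .
    qed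
    then show "eventually (\<lambda>R. ?E ?h ?\<eta> R \<le> ennreal (2 * (cmod a)\<^sup>2) * ?E f \<phi> R + ennreal (2 * (cmod b)\<^sup>2) * ?E g \<gamma> R) at_top"
      by simp
    have "((\<lambda>R. ennreal (2 * (cmod a)\<^sup>2) * ?E f \<phi> R + ennreal (2 * (cmod b)\<^sup>2) * ?E g \<gamma> R) \<longlongrightarrow>
        ennreal (2 * (cmod a)\<^sup>2) * 0 + ennreal (2 * (cmod b)\<^sup>2) * 0) at_top"
      using f g by (intro tendsto_add ennreal_tendsto_cmult) (auto simp: has_fourier_transform_def)
    then show "((\<lambda>R. ennreal (2 * (cmod a)\<^sup>2) * ?E f \<phi> R + ennreal (2 * (cmod b)\<^sup>2) * ?E g \<gamma> R) \<longlongrightarrow> 0) at_top"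
      by simp
  qed
  then show ?thesis
    using sq by (simp add: has_fourier_transform_def square_integrable_lincomb)
qed

text \<open>By linearity \<open>\<phi> - \<psi>\<close> is a transform of \<open>0\<close>, whose
  truncations have Fourier integral \<open>0\<close>. The distance in the definition is then
  constant in \<open>R\<close> and tends to \<open>0\<close>, so it is \<open>0\<close>.\<close>

lemma has_fourier_transform_unique:
  assumes "has_fourier_transform f \<phi>" "has_fourier_transform f \<psi>"
  shows "AE \<xi> in lborel. \<phi> \<xi> = \<psi> \<xi>"
proof -
  have [measurable]: "\<phi> \<in> borel_measurable borel" "\<psi> \<in> borel_measurable borel"
    using assms by (auto simp: square_integrable_def has_fourier_transform_def)
  have "has_fourier_transform (\<lambda>x. 0) (\<lambda>\<xi>. \<phi> \<xi> - \<psi> \<xi>)"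
    using has_fourier_transform_lincomb[OF assms, of 1 "-1"] by simp
  then have "((\<lambda>R::real. \<integral>\<^sup>+ \<xi>. ennreal ((cmod (\<phi> \<xi> - \<psi> \<xi>))\<^sup>2) \<partial>lborel) \<longlongrightarrow> 0) at_top"
    by (simp add: has_fourier_transform_def fourier_integral_def norm_minus_commute)
  then have "(\<integral>\<^sup>+ \<xi>. ennreal ((cmod (\<phi> \<xi> - \<psi> \<xi>))\<^sup>2) \<partial>lborel) = 0"
    by (simp add: tendsto_const_iff)
  then show ?thesis
    by (subst (asm) nn_integral_0_iff_AE) auto
qed

text \<open>Allows an element of \<open>sobolev\<close> to be replaced by a continuous
  representative before the inversion formula is applied.\<close>

lemma has_fourier_transform_cong_AE:
  assumes f: "has_fourier_transform f \<phi>" and [measurable]: "g \<in> borel_measurable borel"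
    and eq: "AE x in lborel. f x = g x"
  shows "has_fourier_transform g \<phi>"
proof -
  have [measurable]: "f \<in> borel_measurable borel"
    using f by (auto simp: square_integrable_def has_fourier_transform_def)
  have "integrable lborel (\<lambda>x. (norm (f x))\<^sup>2) \<longleftrightarrow> integrable lborel (\<lambda>x. (norm (g x))\<^sup>2)"
    by (rule integrable_cong_AE) (use eq in auto)
  moreover have "fourier_integral (\<lambda>x. indicator {-R..R} x *\<^sub>R f x) = fourier_integral (\<lambda>x. indicator {-R..R} x *\<^sub>R g x)" for R
    unfolding fourier_integral_def fun_eq_iff
    by (intro allI integral_cong_AE) (use eq in auto)
  ultimately show ?thesis
    using f by (simp add: has_fourier_transform_def square_integrable_def)
qed

lemma sobolev_lincomb:
  assumes f: "f \<in> sobolev s" and g: "g \<in> sobolev s"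
  shows "(\<lambda>x. a * f x + b * g x) \<in> sobolev s"
proof -
  obtain \<phi> \<gamma> where \<phi>: "has_fourier_transform (\<lambda>x. complex_of_real (f x)) \<phi>"
      "integrable lborel (\<lambda>\<xi>. (1 + \<xi>\<^sup>2) powr s * (cmod (\<phi> \<xi>))\<^sup>2)"
    and \<gamma>: "has_fourier_transform (\<lambda>x. complex_of_real (g x)) \<gamma>"
      "integrable lborel (\<lambda>\<xi>. (1 + \<xi>\<^sup>2) powr s * (cmod (\<gamma> \<xi>))\<^sup>2)"
    using f g by (auto simp: sobolev_def)
  have [measurable]: "\<phi> \<in> borel_measurable borel" "\<gamma> \<in> borel_measurable borel"
    using \<phi>(1) \<gamma>(1) by (auto simp: square_integrable_def has_fourier_transform_def)
  let ?\<eta> = "\<lambda>\<xi>. complex_of_real a * \<phi> \<xi> + complex_of_real b * \<gamma> \<xi>"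
  have "has_fourier_transform (\<lambda>x. complex_of_real (a * f x + b * g x)) ?\<eta>"
    using has_fourier_transform_lincomb[OF \<phi>(1) \<gamma>(1), of "of_real a" "of_real b"] by simp
  moreover have "integrable lborel (\<lambda>\<xi>. (1 + \<xi>\<^sup>2) powr s * (cmod (?\<eta> \<xi>))\<^sup>2)"
  proof (rule Bochner_Integration.integrable_bound)
    show "integrable lborel (\<lambda>\<xi>. 2 * a\<^sup>2 * ((1 + \<xi>\<^sup>2) powr s * (cmod (\<phi> \<xi>))\<^sup>2) + 2 * b\<^sup>2 * ((1 + \<xi>\<^sup>2) powr s * (cmod (\<gamma> \<xi>))\<^sup>2))"
      using \<phi>(2) \<gamma>(2) by (intro Bochner_Integration.integrable_add integrable_mult_right)
    have "(1 + \<xi>\<^sup>2) powr s * (cmod (?\<eta> \<xi>))\<^sup>2 \<le>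
       2 * a\<^sup>2 * ((1 + \<xi>\<^sup>2) powr s * (cmod (\<phi> \<xi>))\<^sup>2) + 2 * b\<^sup>2 * ((1 + \<xi>\<^sup>2) powr s * (cmod (\<gamma> \<xi>))\<^sup>2)" for \<xi>
      using mult_left_mono[OF cmod_lincomb_square_le[of "of_real a" "\<phi> \<xi>" "of_real b" "\<gamma> \<xi>"], of "(1 + \<xi>\<^sup>2) powr s"]
      by (simp add: algebra_simps)
    then show "AE \<xi> in lborel. norm ((1 + \<xi>\<^sup>2) powr s * (cmod (?\<eta> \<xi>))\<^sup>2) \<le>
       norm (2 * a\<^sup>2 * ((1 + \<xi>\<^sup>2) powr s * (cmod (\<phi> \<xi>))\<^sup>2) + 2 * b\<^sup>2 * ((1 + \<xi>\<^sup>2) powr s * (cmod (\<gamma> \<xi>))\<^sup>2))"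
      by (intro AE_I2) (smt (verit) real_norm_def powr_ge_zero mult_nonneg_nonneg zero_le_power2)
  qed measurable
  ultimately show ?thesis unfolding sobolev_def by blast
qed

text \<open>\<open>sobolev\<close> asks for some transform with finite weighted integral, while
  \<open>sobolev_norm\<close> uses the one chosen by \<open>SOME\<close>. Uniqueness up to null sets
  shows that the chosen one serves both purposes.\<close>

lemma sobolevE_transform:
  assumes h: "h \<in> sobolev s"
  obtains \<phi> where "has_fourier_transform (\<lambda>x. complex_of_real (h x)) \<phi>"
    "integrable lborel (\<lambda>\<xi>. (1 + \<xi>\<^sup>2) powr s * (cmod (\<phi> \<xi>))\<^sup>2)"
    "(LINT \<xi>|lborel. (1 + \<xi>\<^sup>2) powr s * (cmod (\<phi> \<xi>))\<^sup>2) = 2 * pi * (sobolev_norm s h)\<^sup>2"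
proof -
  obtain \<phi> where \<phi>: "has_fourier_transform (\<lambda>x. complex_of_real (h x)) \<phi>"
      "integrable lborel (\<lambda>\<xi>. (1 + \<xi>\<^sup>2) powr s * (cmod (\<phi> \<xi>))\<^sup>2)"
    using h by (auto simp: sobolev_def)
  let ?\<psi> = "fourier_transform (\<lambda>x. complex_of_real (h x))"
  have \<psi>: "has_fourier_transform (\<lambda>x. complex_of_real (h x)) ?\<psi>"
    unfolding fourier_transform_def
    using someI[of "has_fourier_transform (\<lambda>x. complex_of_real (h x))", OF \<phi>(1)] .
  have [measurable]: "\<phi> \<in> borel_measurable borel" "?\<psi> \<in> borel_measurable borel"
    using \<phi>(1) \<psi> by (auto simp: square_integrable_def has_fourier_transform_def)
  have eq: "AE \<xi> in lborel. ?\<psi> \<xi> = \<phi> \<xi>"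
    by (rule has_fourier_transform_unique[OF \<psi> \<phi>(1)])
  have int: "integrable lborel (\<lambda>\<xi>. (1 + \<xi>\<^sup>2) powr s * (cmod (?\<psi> \<xi>))\<^sup>2)"
    by (rule integrable_cong_AE_imp[OF \<phi>(2)]) (use eq in auto)
  have "0 \<le> (LINT \<xi>|lborel. (1 + \<xi>\<^sup>2) powr s * (cmod (?\<psi> \<xi>))\<^sup>2)"
    by (intro integral_nonneg_AE AE_I2) simp
  then have "(LINT \<xi>|lborel. (1 + \<xi>\<^sup>2) powr s * (cmod (?\<psi> \<xi>))\<^sup>2) = 2 * pi * (sobolev_norm s h)\<^sup>2"
    by (simp add: sobolev_norm_def)
  then show ?thesis using that \<psi> int by blast
qed

lemma sobolev_norm_nonneg: "0 \<le> sobolev_norm s h"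
  unfolding sobolev_norm_def by (intro real_sqrt_ge_zero mult_nonneg_nonneg integral_nonneg_AE AE_I2) auto

section \<open>From weighted L2 bounds on the transform to pointwise bounds on the function\<close>

lemma integrable_one_plus_square_powr:
  fixes q :: real
  assumes q: "q > 1 / 2"
  shows "integrable lborel (\<lambda>\<xi>::real. (1 + \<xi>\<^sup>2) powr - q)"
proof -
  \<comment> \<open>A majorant on the half-line, symmetrised below: \<open>1\<close> up to the point
    \<open>1\<close>, and beyond it the power with exponent \<open>- (2 * q) < - 1\<close>.\<close>
  define g where "g = (\<lambda>\<xi>::real. indicator {0..1} \<xi> + \<xi> powr (- (2 * q)) * indicator {1..} \<xi>)"
  have [measurable]: "g \<in> borel_measurable borel" by (simp add: g_def)
  have tail: "integrable lborel (\<lambda>\<xi>::real. \<xi> powr (- (2 * q)) * indicator {1..} \<xi>)"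
  proof (rule integrableI_nonneg)
    have "(\<integral>\<^sup>+ \<xi>. ennreal (\<xi> powr (- (2 * q))) * indicator {1..} \<xi> \<partial>lborel) = ennreal (0 - 1 powr (1 - 2 * q) / (1 - 2 * q))"
    proof (rule nn_integral_FTC_atLeast[where F = "\<lambda>x. x powr (1 - 2 * q) / (1 - 2 * q)"])
      show "((\<lambda>x. x powr (1 - 2 * q) / (1 - 2 * q)) has_real_derivative x powr (- (2 * q))) (at x)"
        if "1 \<le> x" for x :: real
        using that q by (auto intro!: derivative_eq_intros)
      show "((\<lambda>x::real. x powr (1 - 2 * q) / (1 - 2 * q)) \<longlongrightarrow> 0) at_top"
        using tendsto_divide[OF tendsto_neg_powr[OF _ filterlim_ident] tendsto_const[of "1 - 2 * q"]] q by simp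
    qed auto
    moreover have "ennreal (\<xi> powr (- (2 * q)) * indicator {1..} \<xi>) = ennreal (\<xi> powr (- (2 * q))) * indicator {1..} \<xi>" for \<xi> :: real
      by (simp add: indicator_def)
    ultimately show "(\<integral>\<^sup>+ \<xi>. ennreal (\<xi> powr (- (2 * q)) * indicator {1..} \<xi>) \<partial>(lborel :: real measure)) < \<infinity>"
      by simp
  qed auto
  have g_int: "integrable lborel g"
    unfolding g_def using tail by (intro Bochner_Integration.integrable_add integrable_real_indicator) (auto simp: emeasure_lborel_Icc_eq)
  have "integrable lborel (\<lambda>\<xi>. g \<xi> + g (0 + (- 1) * \<xi>))"
    using g_int by (intro Bochner_Integration.integrable_add lborel_integrable_real_affine) auto
  then show ?thesis
  proof (rule Bochner_Integration.integrable_bound, measurable, intro AE_I2)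
    fix \<xi> :: real
    have le1: "(1 + \<xi>\<^sup>2) powr - q \<le> 1"
      using powr_mono2'[of "- q" 1 "1 + \<xi>\<^sup>2"] q by simp
    have g0: "0 \<le> g \<eta>" for \<eta> by (auto simp: g_def indicator_def)
    have "(1 + \<xi>\<^sup>2) powr - q \<le> \<bar>\<xi>\<bar> powr (- (2 * q))" if "\<bar>\<xi>\<bar> \<ge> 1"
    proof -
      have "(1 + \<xi>\<^sup>2) powr - q \<le> (\<bar>\<xi>\<bar> powr 2) powr - q"
        using that q by (intro powr_mono2') (auto simp: powr_numeral)
      then show ?thesis unfolding powr_powr by simp
    qed
    then have "(1 + \<xi>\<^sup>2) powr - q \<le> g \<bar>\<xi>\<bar>"
      using le1 by (cases "\<bar>\<xi>\<bar> \<ge> 1") (auto simp: g_def indicator_def intro: order_trans)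
    also have "\<dots> \<le> g \<xi> + g (- \<xi>)"
      using g0[of \<xi>] g0[of "- \<xi>"] by (cases "\<xi> \<ge> 0") auto
    finally show "norm ((1 + \<xi>\<^sup>2) powr - q) \<le> norm (g \<xi> + g (0 + (- 1) * \<xi>))"
      using g0[of \<xi>] g0[of "- \<xi>"] by simp
  qed
qed

text \<open>Cauchy-Schwarz with the exponent \<open>r / 2\<close> split as
  \<open>- (p - r) / 2\<close> plus \<open>p / 2\<close>; the condition on \<open>p - r\<close>
  makes the square of the first weight integrable. The value \<open>r = 0\<close> serves the sup
  bound of a function, \<open>r = 1\<close> that of its derivative.\<close>

lemma weighted_fourier_L1_bound:
  fixes \<phi> :: "real \<Rightarrow> complex" and p r :: real
  assumes pr: "p - r > 1 / 2" and [measurable]: "\<phi> \<in> borel_measurable borel"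
    and w: "integrable lborel (\<lambda>\<xi>. (1 + \<xi>\<^sup>2) powr p * (cmod (\<phi> \<xi>))\<^sup>2)"
  shows "integrable lborel (\<lambda>\<xi>. (1 + \<xi>\<^sup>2) powr (r / 2) * cmod (\<phi> \<xi>))"
    and "(LINT \<xi>|lborel. (1 + \<xi>\<^sup>2) powr (r / 2) * cmod (\<phi> \<xi>)) \<le>
          sqrt ((LINT \<xi>|lborel. (1 + \<xi>\<^sup>2) powr - (p - r)) * (LINT \<xi>|lborel. (1 + \<xi>\<^sup>2) powr p * (cmod (\<phi> \<xi>))\<^sup>2))"
proof -
  define a where "a \<xi> = (1 + \<xi>\<^sup>2) powr (- (p - r) / 2)" for \<xi> :: real
  define b where "b \<xi> = (1 + \<xi>\<^sup>2) powr (p / 2) * cmod (\<phi> \<xi>)" for \<xi> :: real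
  have [measurable]: "a \<in> borel_measurable borel" "b \<in> borel_measurable borel"
    by (simp_all add: a_def[abs_def] b_def[abs_def])
  have pos: "1 + \<xi>\<^sup>2 > 0" for \<xi> :: real by (simp add: add_pos_nonneg)
  have sq: "(y powr (c / 2))\<^sup>2 = y powr c" if "y > 0" for y c :: real
    using that by (simp add: power2_eq_square powr_add[symmetric])
  have a2: "(\<lambda>\<xi>. (a \<xi>)\<^sup>2) = (\<lambda>\<xi>. (1 + \<xi>\<^sup>2) powr - (p - r))"
    unfolding a_def using sq[OF pos] by simp
  have b2: "(\<lambda>\<xi>. (b \<xi>)\<^sup>2) = (\<lambda>\<xi>. (1 + \<xi>\<^sup>2) powr p * (cmod (\<phi> \<xi>))\<^sup>2)"
    unfolding b_def using sq[OF pos] by (simp add: power_mult_distrib)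
  have ab: "a \<xi> * b \<xi> = (1 + \<xi>\<^sup>2) powr (r / 2) * cmod (\<phi> \<xi>)" for \<xi>
  proof -
    have *: "- (p - r) / 2 + p / 2 = r / 2" by (simp add: field_simps)
    show ?thesis
      unfolding a_def b_def mult.assoc[symmetric] powr_add[symmetric] * ..
  qed
  have ai: "integrable lborel (\<lambda>\<xi>. (a \<xi>)\<^sup>2)"
    unfolding a2 by (rule integrable_one_plus_square_powr[OF pr])
  have bi: "integrable lborel (\<lambda>\<xi>. (b \<xi>)\<^sup>2)"
    unfolding b2 by (rule w)
  show "integrable lborel (\<lambda>\<xi>. (1 + \<xi>\<^sup>2) powr (r / 2) * cmod (\<phi> \<xi>))"
    using integral_cauchy_schwarz(1)[OF _ _ ai bi] by (simp add: ab)
  show "(LINT \<xi>|lborel. (1 + \<xi>\<^sup>2) powr (r / 2) * cmod (\<phi> \<xi>)) \<le>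
          sqrt ((LINT \<xi>|lborel. (1 + \<xi>\<^sup>2) powr - (p - r)) * (LINT \<xi>|lborel. (1 + \<xi>\<^sup>2) powr p * (cmod (\<phi> \<xi>))\<^sup>2))"
    using integral_cauchy_schwarz(2)[OF _ _ ai bi] unfolding ab a2 b2 by (intro real_le_rsqrt) simp
qed

lemma sobolev_fourier_L1_bound:
  assumes pr: "p - r > 1 / 2"
  obtains C where "C \<ge> 0"
    "\<And>h. h \<in> sobolev p \<Longrightarrow> \<exists>\<phi>. has_fourier_transform (\<lambda>x. complex_of_real (h x)) \<phi> \<and>
        integrable lborel (\<lambda>\<xi>. (1 + \<xi>\<^sup>2) powr (r / 2) * cmod (\<phi> \<xi>)) \<and>
        (LINT \<xi>|lborel. (1 + \<xi>\<^sup>2) powr (r / 2) * cmod (\<phi> \<xi>)) \<le> C * sobolev_norm p h"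
proof
  let ?J = "LINT \<xi>|(lborel :: real measure). (1 + \<xi>\<^sup>2) powr - (p - r)"
  show "sqrt (?J * (2 * pi)) \<ge> 0"
    by (intro real_sqrt_ge_zero mult_nonneg_nonneg integral_nonneg_AE AE_I2) auto
  fix h assume "h \<in> sobolev p"
  then obtain \<phi> where \<phi>: "has_fourier_transform (\<lambda>x. complex_of_real (h x)) \<phi>"
    "integrable lborel (\<lambda>\<xi>. (1 + \<xi>\<^sup>2) powr p * (cmod (\<phi> \<xi>))\<^sup>2)"
    "(LINT \<xi>|lborel. (1 + \<xi>\<^sup>2) powr p * (cmod (\<phi> \<xi>))\<^sup>2) = 2 * pi * (sobolev_norm p h)\<^sup>2"
    by (rule sobolevE_transform)
  have "\<phi> \<in> borel_measurable borel"
    using \<phi>(1) by (auto simp: square_integrable_def has_fourier_transform_def)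
  note L1 = weighted_fourier_L1_bound[OF pr this \<phi>(2)]
  have "sqrt (?J * (2 * pi * (sobolev_norm p h)\<^sup>2)) = sqrt (?J * (2 * pi)) * sobolev_norm p h"
    using sobolev_norm_nonneg[of p h] by (simp add: real_sqrt_mult)
  then show "\<exists>\<phi>. has_fourier_transform (\<lambda>x. complex_of_real (h x)) \<phi> \<and>
        integrable lborel (\<lambda>\<xi>. (1 + \<xi>\<^sup>2) powr (r / 2) * cmod (\<phi> \<xi>)) \<and>
        (LINT \<xi>|lborel. (1 + \<xi>\<^sup>2) powr (r / 2) * cmod (\<phi> \<xi>)) \<le> sqrt (?J * (2 * pi)) * sobolev_norm p h"
    using \<phi>(1) L1 unfolding \<phi>(3) by auto
qed

text \<open>The element \<open>h\<close> of the space and the continuous \<open>c\<close> are kept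
  apart because the bound is later used for a difference quotient in time minus \<open>v t\<close>,
  and \<open>v t\<close> is known only almost everywhere.\<close>

lemma sobolev_sup_bound:
  assumes p: "p > 1 / 2"
  obtains C where "C \<ge> 0"
    "\<And>h c x. h \<in> sobolev p \<Longrightarrow> continuous_on UNIV c \<Longrightarrow> AE x in lborel. h x = c x \<Longrightarrow>
       \<bar>c x\<bar> \<le> C * sobolev_norm p h"
proof -
  have "p - 0 > 1 / 2" using p by simp
  from sobolev_fourier_L1_bound[OF this] obtain C where C: "C \<ge> 0"
    "\<And>h. h \<in> sobolev p \<Longrightarrow> \<exists>\<phi>. has_fourier_transform (\<lambda>x. complex_of_real (h x)) \<phi> \<and>
        integrable lborel (\<lambda>\<xi>. (1 + \<xi>\<^sup>2) powr (0 / 2) * cmod (\<phi> \<xi>)) \<and>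
        (LINT \<xi>|lborel. (1 + \<xi>\<^sup>2) powr (0 / 2) * cmod (\<phi> \<xi>)) \<le> C * sobolev_norm p h"
    by blast
  \<comment> \<open>The base has to be nonzero here, since \<open>0 powr 0\<close> is
    \<open>0\<close>.\<close>
  have one: "(1 + \<xi>\<^sup>2) powr (0 / 2) = (1 :: real)" for \<xi> :: real
    using zero_le_power2[of \<xi>] by (simp add: powr_zero_eq_one add_nonneg_eq_0_iff)
  show ?thesis
  proof (rule that[OF C(1)])
    fix h c :: "real \<Rightarrow> real" and x
    assume h: "h \<in> sobolev p" and c: "continuous_on UNIV c" and eq: "AE x in lborel. h x = c x"
    have [measurable]: "c \<in> borel_measurable borel" using c by (rule borel_measurable_continuous_onI)
    obtain \<phi> where \<phi>: "has_fourier_transform (\<lambda>x. complex_of_real (h x)) \<phi>"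
        "integrable lborel (\<lambda>\<xi>. cmod (\<phi> \<xi>))" "(LINT \<xi>|lborel. cmod (\<phi> \<xi>)) \<le> C * sobolev_norm p h"
      using C(2)[OF h] unfolding one by auto
    have [measurable]: "\<phi> \<in> borel_measurable borel"
      using \<phi>(1) by (auto simp: square_integrable_def has_fourier_transform_def)
    have "has_fourier_transform (\<lambda>x. complex_of_real (c x)) \<phi>"
      by (rule has_fourier_transform_cong_AE[OF \<phi>(1)]) (use eq in auto)
    moreover have "integrable lborel \<phi>" using \<phi>(2) by (simp add: integrable_norm_iff)
    moreover have "continuous_on UNIV (\<lambda>x. complex_of_real (c x))"
      using c by (intro continuous_intros) auto
    ultimately have "cmod (complex_of_real (c x)) \<le> (LINT \<xi>|lborel. cmod (\<phi> \<xi>))"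
      by (rule cmod_le_of_fourier_transform)
    then show "\<bar>c x\<bar> \<le> C * sobolev_norm p h" using \<phi>(3) by simp
  qed
qed

text \<open>By the mean value inequality the bound \<open>w\<close> on \<open>r'\<close> also bounds
  the difference quotients of \<open>r\<close>, so dominated convergence applies to them.\<close>

lemma has_real_derivative_lebesgue_integral:
  fixes r r' :: "real \<Rightarrow> 'a \<Rightarrow> real"
  assumes int: "\<And>x. integrable M (r x)"
    and der: "\<And>x \<xi>. ((\<lambda>x. r x \<xi>) has_real_derivative r' x \<xi>) (at x)"
    and bound: "\<And>x \<xi>. \<bar>r' x \<xi>\<bar> \<le> w \<xi>" and w: "integrable M w"
    and [measurable]: "\<And>x. r' x \<in> borel_measurable M"
  shows "((\<lambda>x. LINT \<xi>|M. r x \<xi>) has_real_derivative (LINT \<xi>|M. r' x \<xi>)) (at x)"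
  unfolding has_field_derivative_iff tendsto_at_iff_sequentially
proof (intro allI impI)
  fix X :: "nat \<Rightarrow> real"
  assume X: "\<forall>i. X i \<in> UNIV - {x}" "X \<longlonglongrightarrow> x"
  have [measurable]: "r x \<in> borel_measurable M" for x using int[of x] by auto
  have "(\<lambda>i. LINT \<xi>|M. (r (X i) \<xi> - r x \<xi>) / (X i - x)) \<longlonglongrightarrow> (LINT \<xi>|M. r' x \<xi>)"
  proof (rule integral_dominated_convergence[where w = w])
    show "AE \<xi> in M. (\<lambda>i. (r (X i) \<xi> - r x \<xi>) / (X i - x)) \<longlonglongrightarrow> r' x \<xi>"
      using der X unfolding has_field_derivative_iff tendsto_at_iff_sequentially by (auto simp: o_def)
    have lip: "\<bar>r y \<xi> - r x \<xi>\<bar> \<le> w \<xi> * \<bar>y - x\<bar>" for y \<xi>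
      using field_differentiable_bound[of UNIV "\<lambda>x. r x \<xi>" "\<lambda>x. r' x \<xi>" "w \<xi>" y x] der bound by simp
    show "AE \<xi> in M. norm ((r (X i) \<xi> - r x \<xi>) / (X i - x)) \<le> w \<xi>" for i
      using lip[of "X i"] X(1) by (intro AE_I2) (auto simp: abs_divide pos_divide_le_eq)
  qed (use w in measurable)
  then show "((\<lambda>y. ((LINT \<xi>|M. r y \<xi>) - (LINT \<xi>|M. r x \<xi>)) / (y - x)) \<circ> X) \<longlonglongrightarrow> (LINT \<xi>|M. r' x \<xi>)"
    using int by (simp add: o_def)
qed

text \<open>The inversion formula is differentiated under the integral. The weight with exponent
  \<open>1 / 2\<close> is \<open>sqrt (1 + \<xi>\<^sup>2)\<close>, which dominates both
  \<open>1\<close> and \<open>\<bar>\<xi>\<bar>\<close>; hence the single majorant \<open>W\<close>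
  serves the integrand and its derivative.\<close>

lemma sobolev_C1_bound:
  assumes p: "p > 3 / 2"
  obtains C where "C \<ge> 0"
    "\<And>h. h \<in> sobolev p \<Longrightarrow> continuous_on UNIV h \<Longrightarrow>
       (\<forall>x. (h has_real_derivative deriv h x) (at x)) \<and> continuous_on UNIV (deriv h) \<and>
       (\<forall>x. \<bar>deriv h x\<bar> \<le> C * sobolev_norm p h)"
proof -
  have "p - 1 > 1 / 2" using p by simp
  from sobolev_fourier_L1_bound[OF this] obtain C where C: "C \<ge> 0"
    "\<And>h. h \<in> sobolev p \<Longrightarrow> \<exists>\<phi>. has_fourier_transform (\<lambda>x. complex_of_real (h x)) \<phi> \<and>
        integrable lborel (\<lambda>\<xi>. (1 + \<xi>\<^sup>2) powr (1 / 2) * cmod (\<phi> \<xi>)) \<and>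
        (LINT \<xi>|lborel. (1 + \<xi>\<^sup>2) powr (1 / 2) * cmod (\<phi> \<xi>)) \<le> C * sobolev_norm p h"
    by blast
  show ?thesis
  proof (rule that[OF C(1)])
    fix h assume h: "h \<in> sobolev p" and cont: "continuous_on UNIV h"
    obtain \<phi> where \<phi>: "has_fourier_transform (\<lambda>x. complex_of_real (h x)) \<phi>"
        "integrable lborel (\<lambda>\<xi>. (1 + \<xi>\<^sup>2) powr (1 / 2) * cmod (\<phi> \<xi>))"
        "(LINT \<xi>|lborel. (1 + \<xi>\<^sup>2) powr (1 / 2) * cmod (\<phi> \<xi>)) \<le> C * sobolev_norm p h"
      using C(2)[OF h] by auto
    have [measurable]: "\<phi> \<in> borel_measurable borel"
      using \<phi>(1) by (auto simp: square_integrable_def has_fourier_transform_def)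
    define W where "W \<xi> = (1 + \<xi>\<^sup>2) powr (1 / 2) * cmod (\<phi> \<xi>)" for \<xi> :: real
    have W: "cmod (\<phi> \<xi>) \<le> W \<xi>" "\<bar>\<xi>\<bar> * cmod (\<phi> \<xi>) \<le> W \<xi>" for \<xi>
    proof -
      have root: "(1 + \<xi>\<^sup>2) powr (1 / 2) = sqrt (1 + \<xi>\<^sup>2)"
        by (rule powr_half_sqrt) simp
      have "1 \<le> sqrt (1 + \<xi>\<^sup>2)" by simp
      moreover have "\<bar>\<xi>\<bar> \<le> sqrt (1 + \<xi>\<^sup>2)" by (intro real_le_rsqrt) simp
      ultimately show "cmod (\<phi> \<xi>) \<le> W \<xi>" "\<bar>\<xi>\<bar> * cmod (\<phi> \<xi>) \<le> W \<xi>"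
        unfolding W_def root using mult_right_mono[of 1 "sqrt (1 + \<xi>\<^sup>2)" "cmod (\<phi> \<xi>)"] by (auto intro!: mult_right_mono)
    qed
    have W_int: "integrable lborel W" unfolding W_def[abs_def] by (rule \<phi>(2))
    have [measurable]: "W \<in> borel_measurable borel" using W_int by auto
    have \<phi>_int: "integrable lborel \<phi>"
      by (rule Bochner_Integration.integrable_bound[OF W_int])
         (use W(1) in \<open>auto intro: order_trans[OF _ abs_ge_self]\<close>)
    \<comment> \<open>The real part of \<open>cis (x * \<xi>) * \<phi> \<xi>\<close>. As
      \<open>h\<close> is real, it carries the whole inversion formula, and the real-valued
      differentiation lemma applies.\<close>
    define r where "r x \<xi> = cos (x * \<xi>) * Re (\<phi> \<xi>) - sin (x * \<xi>) * Im (\<phi> \<xi>)" for x \<xi>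
    define r' where "r' x \<xi> = - \<xi> * (sin (x * \<xi>) * Re (\<phi> \<xi>) + cos (x * \<xi>) * Im (\<phi> \<xi>))" for x \<xi>
    have r_Re: "r x \<xi> = Re (cis (x * \<xi>) * \<phi> \<xi>)" for x \<xi> by (simp add: r_def)
    have r'_Im: "r' x \<xi> = - \<xi> * Im (cis (x * \<xi>) * \<phi> \<xi>)" for x \<xi> by (simp add: r'_def)
    have [measurable]: "r x \<in> borel_measurable lborel" "r' x \<in> borel_measurable lborel" for x
      by (simp_all add: r_def[abs_def] r'_def[abs_def])
    have cis_int: "integrable lborel (\<lambda>\<xi>. cis (x * \<xi>) * \<phi> \<xi>)" for x
      by (rule Bochner_Integration.integrable_bound[OF \<phi>_int]) (auto simp: norm_mult)
    have r_int: "integrable lborel (r x)" for x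
      unfolding r_Re[abs_def] using cis_int by (rule integrable_Re)
    have h_eq: "h x = 1 / (2 * pi) * (LINT \<xi>|lborel. r x \<xi>)" for x
    proof -
      have "complex_of_real (h x) = 1 / (2 * pi) * (LINT \<xi>|lborel. cis (x * \<xi>) * \<phi> \<xi>)"
        using cont by (intro fourier_inversion[OF \<phi>(1) \<phi>_int] continuous_intros) auto
      then have "Re (complex_of_real (h x)) = Re (complex_of_real (1 / (2 * pi)) * (LINT \<xi>|lborel. cis (x * \<xi>) * \<phi> \<xi>))"
        by (rule arg_cong)
      also have "\<dots> = 1 / (2 * pi) * Re (LINT \<xi>|lborel. cis (x * \<xi>) * \<phi> \<xi>)"
        by simp
      also have "Re (LINT \<xi>|lborel. cis (x * \<xi>) * \<phi> \<xi>) = (LINT \<xi>|lborel. r x \<xi>)"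
        unfolding r_Re using cis_int by (rule integral_Re[symmetric])
      finally show ?thesis by simp
    qed
    have r'_bound: "\<bar>r' x \<xi>\<bar> \<le> W \<xi>" for x \<xi>
    proof -
      have "\<bar>r' x \<xi>\<bar> \<le> \<bar>\<xi>\<bar> * cmod (cis (x * \<xi>) * \<phi> \<xi>)"
        unfolding r'_Im abs_mult abs_minus_cancel by (intro mult_left_mono abs_Im_le_cmod) auto
      then show ?thesis using W(2)[of \<xi>] by (simp add: norm_mult)
    qed
    define D where "D x = 1 / (2 * pi) * (LINT \<xi>|lborel. r' x \<xi>)" for x
    have hD: "(h has_real_derivative D x) (at x)" for x
    proof -
      have "((\<lambda>x. LINT \<xi>|lborel. r x \<xi>) has_real_derivative (LINT \<xi>|lborel. r' x \<xi>)) (at x)"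
      proof (rule has_real_derivative_lebesgue_integral[where w = W])
        show "((\<lambda>x. r x \<xi>) has_real_derivative r' x \<xi>) (at x)" for x \<xi>
          unfolding r_def r'_def by (auto intro!: derivative_eq_intros simp: algebra_simps)
        show "integrable lborel (r x)" "\<bar>r' x \<xi>\<bar> \<le> W \<xi>" "r' x \<in> borel_measurable lborel" for x \<xi>
          by (fact r_int, fact r'_bound, measurable)
      qed (fact W_int)
      then have "((\<lambda>x. 1 / (2 * pi) * (LINT \<xi>|lborel. r x \<xi>)) has_real_derivative D x) (at x)"
        unfolding D_def by (rule DERIV_cmult)
      then show ?thesis by (simp only: h_eq[symmetric])
    qed
    then have deriv_eq: "deriv h = D" by (intro ext DERIV_imp_deriv)
    have "continuous_on UNIV D"
    proof (rule continuous_on_sequentiallyI)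
      fix X :: "nat \<Rightarrow> real" and a assume X: "X \<longlonglongrightarrow> a"
      have "(\<lambda>n. LINT \<xi>|lborel. r' (X n) \<xi>) \<longlonglongrightarrow> (LINT \<xi>|lborel. r' a \<xi>)"
      proof (rule integral_dominated_convergence[where w = W])
        show "AE \<xi> in lborel. (\<lambda>n. r' (X n) \<xi>) \<longlonglongrightarrow> r' a \<xi>"
          unfolding r'_def using X by (intro AE_I2 tendsto_mult tendsto_add tendsto_const tendsto_sin tendsto_cos)
        show "AE \<xi> in lborel. norm (r' (X n) \<xi>) \<le> W \<xi>" for n
          using r'_bound by simp
      qed (use W_int in measurable)
      then show "(\<lambda>n. D (X n)) \<longlonglongrightarrow> D a"
        unfolding D_def by (rule tendsto_mult_left)
    qed
    moreover have "\<bar>D x\<bar> \<le> C * sobolev_norm p h" for x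
    proof -
      have "\<bar>D x\<bar> = 1 / (2 * pi) * \<bar>LINT \<xi>|lborel. r' x \<xi>\<bar>"
        by (simp add: D_def abs_mult)
      also have "\<dots> \<le> 1 * (LINT \<xi>|lborel. W \<xi>)"
      proof (rule mult_mono)
        show "1 / (2 * pi) \<le> 1" using pi_gt3 by simp
        show "\<bar>LINT \<xi>|lborel. r' x \<xi>\<bar> \<le> (LINT \<xi>|lborel. W \<xi>)"
          unfolding real_norm_def[symmetric]
        proof (rule Bochner_Integration.integral_norm_bound_integral)
          show "integrable lborel (r' x)"
            by (rule Bochner_Integration.integrable_bound[OF W_int])
               (use r'_bound[of x] in \<open>auto intro: order_trans[OF _ abs_ge_self]\<close>)
        qed (use W_int r'_bound in simp_all)
      qed auto
      finally show ?thesis using \<phi>(3) by (simp add: W_def[abs_def])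
    qed
    ultimately show "(\<forall>x. (h has_real_derivative deriv h x) (at x)) \<and> continuous_on UNIV (deriv h) \<and>
       (\<forall>x. \<bar>deriv h x\<bar> \<le> C * sobolev_norm p h)"
      using hD unfolding deriv_eq by auto
  qed
qed

section \<open>The Helmholtz kernel\<close>

text \<open>The contribution of the half-line \<open>{..x}\<close> to
  \<open>inv_helmholtz f x\<close>: there the kernel factors into a function of \<open>x\<close> and
  one of \<open>y\<close>, so \<open>x\<close> can be differentiated as a limit of integration. The
  other half-line is obtained by reflection.\<close>

definition helmholtz_left :: "(real \<Rightarrow> real) \<Rightarrow> real \<Rightarrow> real" where
  "helmholtz_left f x = exp (- x) / 2 * (LINT y|lborel. indicator {..x} y * (exp y * f y))"

lemma has_bochner_integral_exp_atMost:
  "has_bochner_integral lborel (\<lambda>y. indicator {..x} y * exp y) (exp x :: real)"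
proof -
  have "has_bochner_integral lborel (\<lambda>z. exp (- z) * indicator {- x..} z) (exp x :: real)"
  proof (rule has_bochner_integral_nn_integral)
    have "(\<integral>\<^sup>+ z. ennreal (exp (- z)) * indicator {- x..} z \<partial>lborel) = ennreal (0 - (- exp (- (- x))))"
    proof (rule nn_integral_FTC_atLeast[where F = "\<lambda>z. - exp (- z)"])
      show "((\<lambda>z::real. - exp (- z)) \<longlongrightarrow> 0) at_top" by real_asymp
    qed (auto intro!: derivative_eq_intros)
    moreover have "ennreal (exp (- z) * indicator {- x..} z) = ennreal (exp (- z)) * indicator {- x..} z" for z
      by (simp add: indicator_def)
    ultimately show "(\<integral>\<^sup>+ z. ennreal (exp (- z) * indicator {- x..} z) \<partial>lborel) = ennreal (exp x)"
      by simp
  qed auto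
  then have "has_bochner_integral lborel (\<lambda>z. exp (- (0 + (- 1) * z)) * indicator {- x..} (0 + (- 1) * z)) (exp x /\<^sub>R \<bar>- 1\<bar>)"
    by (subst lborel_has_bochner_integral_real_affine_iff[symmetric]) auto
  then show ?thesis
    by (simp add: indicator_def mult.commute)
qed

lemma integrable_exp_mult_atMost:
  fixes f :: "real \<Rightarrow> real"
  assumes f: "continuous_on UNIV f" "\<And>y. \<bar>f y\<bar> \<le> M"
  shows "integrable lborel (\<lambda>y. indicator {..x} y * (exp y * f y))"
proof -
  have [measurable]: "f \<in> borel_measurable borel" using f(1) by (rule borel_measurable_continuous_onI)
  have "integrable lborel (\<lambda>y. indicator {..x} y * exp y * M)"
    using has_bochner_integral_exp_atMost[of x] by (intro integrable_mult_left) (auto simp: has_bochner_integral_iff)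
  then show ?thesis
  proof (rule Bochner_Integration.integrable_bound, measurable, intro AE_I2)
    fix y
    show "norm (indicator {..x} y * (exp y * f y)) \<le> norm (indicator {..x} y * exp y * M)"
      using f(2)[of y] by (auto simp: abs_mult indicator_def intro!: mult_left_mono order_trans[OF _ abs_ge_self])
  qed
qed

lemma abs_helmholtz_left_le:
  assumes f: "continuous_on UNIV f" "\<And>y. \<bar>f y\<bar> \<le> M"
  shows "\<bar>helmholtz_left f x\<bar> \<le> M / 2"
proof -
  have "norm (LINT y|lborel. indicator {..x} y * (exp y * f y)) \<le> (LINT y|lborel. indicator {..x} y * exp y * M)"
  proof (rule Bochner_Integration.integral_norm_bound_integral)
    show "integrable lborel (\<lambda>y. indicator {..x} y * (exp y * f y))"
      by (rule integrable_exp_mult_atMost[OF f])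
    show "integrable lborel (\<lambda>y. indicator {..x} y * exp y * M)"
      using has_bochner_integral_exp_atMost[of x] by (intro integrable_mult_left) (auto simp: has_bochner_integral_iff)
    show "norm (indicator {..x} y * (exp y * f y)) \<le> indicator {..x} y * exp y * M" for y
      using f(2)[of y] by (auto simp: abs_mult indicator_def)
  qed
  also have "\<dots> = exp x * M"
    using has_bochner_integral_exp_atMost[of x] by (auto simp: has_bochner_integral_iff)
  finally have "exp (- x) / 2 * \<bar>LINT y|lborel. indicator {..x} y * (exp y * f y)\<bar> \<le> exp (- x) / 2 * (exp x * M)"
    by (intro mult_left_mono) auto
  also have "\<dots> = M / 2" by (simp add: exp_minus)
  finally show ?thesis
    by (simp add: helmholtz_left_def abs_mult)
qed

lemma has_real_derivative_lebesgue_atMost: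
  fixes g :: "real \<Rightarrow> real"
  assumes int: "\<And>x. integrable lborel (\<lambda>y. indicator {..x} y * g y)" and g: "continuous_on UNIV g"
  shows "((\<lambda>x. LINT y|lborel. indicator {..x} y * g y) has_real_derivative g x) (at x)"
proof -
  define A where "A x = (LINT y|lborel. indicator {..x} y * g y)" for x
  \<comment> \<open>Any point below \<open>x\<close> would do. The integral up to \<open>a\<close>
    is constant, and the fundamental theorem is used on the bounded interval
    \<open>{a..x + 1}\<close>, of which \<open>x\<close> is an interior point.\<close>
  define a where "a = x - 1"
  have [measurable]: "g \<in> borel_measurable borel" using g by (rule borel_measurable_continuous_onI)
  have eq: "A a + integral {a..u} g = A u" if "a < u" for u
  proof -
    have i: "integrable lborel (\<lambda>y. indicator {a..u} y * g y)"
      by (rule Bochner_Integration.integrable_bound[OF int[of u]]) (auto simp: indicator_def)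
    have "A u = (LINT y|lborel. indicator {..a} y * g y + indicator {a..u} y * g y)"
      unfolding A_def
    proof (rule integral_cong_AE)
      show "AE y in lborel. indicator {..u} y * g y = indicator {..a} y * g y + indicator {a..u} y * g y"
        using AE_lborel_singleton[of a] by eventually_elim (use that in \<open>auto simp: indicator_def\<close>)
    qed measurable
    also have "\<dots> = A a + (LINT y|lborel. indicator {a..u} y * g y)"
      unfolding A_def using int i by simp
    also have "(LINT y|lborel. indicator {a..u} y * g y) = integral {a..u} g"
      using set_borel_integral_eq_integral(2)[of "{a..u}" g] i
      by (simp add: set_integrable_def set_lebesgue_integral_def)
    finally show ?thesis by simp
  qed
  have "((\<lambda>u. integral {a..u} g) has_real_derivative g x) (at x within {a..x + 1})"
    by (rule integral_has_real_derivative) (auto intro: continuous_on_subset[OF g] simp: a_def)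
  then have "((\<lambda>u. integral {a..u} g) has_real_derivative g x) (at x)"
    by (subst (asm) at_within_Icc_at) (auto simp: a_def)
  then have "((\<lambda>u. A a + integral {a..u} g) has_real_derivative g x) (at x)"
    by (auto intro!: derivative_eq_intros)
  then have "(A has_real_derivative g x) (at x)"
    by (rule has_field_derivative_transform_within_open[where S = "{a<..}"]) (use eq in \<open>auto simp: a_def\<close>)
  then show ?thesis by (simp add: A_def[abs_def])
qed

lemma DERIV_helmholtz_left:
  assumes f: "continuous_on UNIV f" "\<And>y. \<bar>f y\<bar> \<le> M"
  shows "(helmholtz_left f has_real_derivative f x / 2 - helmholtz_left f x) (at x)"
proof -
  have "continuous_on UNIV (\<lambda>y. exp y * f y)" using f(1) by (intro continuous_intros)
  then have D: "((\<lambda>x. LINT y|lborel. indicator {..x} y * (exp y * f y)) has_real_derivative exp x * f x) (at x)"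
    by (intro has_real_derivative_lebesgue_atMost integrable_exp_mult_atMost[OF f])
  have "(helmholtz_left f has_real_derivative
     (- exp (- x) / 2) * (LINT y|lborel. indicator {..x} y * (exp y * f y)) + (exp x * f x) * (exp (- x) / 2)) (at x)"
    unfolding helmholtz_left_def[abs_def]
    by (rule DERIV_mult[OF _ D]) (auto intro!: derivative_eq_intros)
  also have "(- exp (- x) / 2) * (LINT y|lborel. indicator {..x} y * (exp y * f y)) + (exp x * f x) * (exp (- x) / 2) =
      f x / 2 - helmholtz_left f x"
    by (simp add: helmholtz_left_def exp_minus)
  finally show ?thesis .
qed

lemma inv_helmholtz_split:
  assumes f: "continuous_on UNIV f" "\<And>y. \<bar>f y\<bar> \<le> M"
  shows "integrable lborel (\<lambda>y. exp (- \<bar>x - y\<bar>) / 2 * f y)"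
    and "inv_helmholtz f x = helmholtz_left f x + helmholtz_left (\<lambda>y. f (- y)) (- x)"
proof -
  have [measurable]: "f \<in> borel_measurable borel" using f(1) by (rule borel_measurable_continuous_onI)
  have f': "continuous_on UNIV (\<lambda>y. f (- y))"
    using f(1) by (auto intro!: continuous_on_compose2[OF f(1)] continuous_intros)
  define l where "l y = exp (- x) / 2 * (indicator {..x} y * (exp y * f y))" for y
  define r where "r y = exp x / 2 * (indicator {x..} y * (exp (- y) * f y))" for y
  have [measurable]: "l \<in> borel_measurable borel" "r \<in> borel_measurable borel"
    by (simp_all add: l_def[abs_def] r_def[abs_def])
  have l_int: "integrable lborel l"
    unfolding l_def[abs_def] by (intro integrable_mult_right integrable_exp_mult_atMost[OF f])
  have flip: "exp x / 2 * (indicator {..- x} z * (exp z * f (- z))) = r (0 + (- 1) * z)" for z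
    by (simp add: r_def indicator_def)
  have "integrable lborel (\<lambda>z. r (0 + (- 1) * z))"
    unfolding flip[symmetric] by (intro integrable_mult_right integrable_exp_mult_atMost[OF f', of M] f(2))
  then have r_int: "integrable lborel r"
    by (subst (asm) lborel_integrable_real_affine_iff) auto
  \<comment> \<open>Only almost everywhere: both halves count the point
    \<open>y = x\<close>.\<close>
  have eq: "AE y in lborel. l y + r y = exp (- \<bar>x - y\<bar>) / 2 * f y"
    using AE_lborel_singleton[of x]
    by eventually_elim (auto simp: l_def r_def indicator_def exp_add[symmetric] exp_diff exp_minus field_simps)
  show "integrable lborel (\<lambda>y. exp (- \<bar>x - y\<bar>) / 2 * f y)"
    using Bochner_Integration.integrable_add[OF l_int r_int]
    by (rule integrable_cong_AE_imp) (use eq in auto)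
  have "inv_helmholtz f x = (LINT y|lborel. l y + r y)"
    unfolding inv_helmholtz_def by (rule integral_cong_AE) (use eq in auto)
  also have "\<dots> = (LINT y|lborel. l y) + (LINT y|lborel. r y)"
    using l_int r_int by simp
  also have "(LINT y|lborel. l y) = helmholtz_left f x"
    unfolding l_def helmholtz_left_def by (rule integral_mult_right_zero)
  also have "(LINT y|lborel. r y) = \<bar>- 1\<bar> *\<^sub>R (LINT z|lborel. r (0 + (- 1) * z))"
    by (rule lborel_integral_real_affine) simp
  also have "\<dots> = helmholtz_left (\<lambda>y. f (- y)) (- x)"
    unfolding flip[symmetric] helmholtz_left_def by (subst integral_mult_right_zero) simp
  finally show "inv_helmholtz f x = helmholtz_left f x + helmholtz_left (\<lambda>y. f (- y)) (- x)" .
qed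

text \<open>The halves satisfy L' = f/2 - L and R' = R - f/2. In the derivative R - L of the sum the
  terms in f cancel, so it can be differentiated once more although f is merely continuous, and the
  second derivative is L + R - f. Each half is at most \<open>M / 2\<close> in absolute value, which
  gives both bounds.\<close>

lemma deriv_inv_helmholtz:
  assumes f: "continuous_on UNIV f" "\<And>y. \<bar>f y\<bar> \<le> M"
  shows "(deriv (inv_helmholtz f) has_real_derivative inv_helmholtz f x - f x) (at x)"
    and "\<bar>inv_helmholtz f x\<bar> \<le> M" and "\<bar>deriv (inv_helmholtz f) x\<bar> \<le> M"
proof -
  let ?L = "helmholtz_left f" and ?R = "\<lambda>x. helmholtz_left (\<lambda>y. f (- y)) (- x)"
  have f': "continuous_on UNIV (\<lambda>y. f (- y))"
    using f(1) by (auto intro!: continuous_on_compose2[OF f(1)] continuous_intros)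
  have L: "(?L has_real_derivative f x / 2 - ?L x) (at x)" for x
    by (rule DERIV_helmholtz_left[OF f])
  have R: "(?R has_real_derivative ?R x - f x / 2) (at x)" for x
  proof -
    have "(helmholtz_left (\<lambda>y. f (- y)) has_real_derivative f (- (- x)) / 2 - ?R x) (at (- x))"
      using DERIV_helmholtz_left[OF f', of M "- x"] f(2) by simp
    then have "(?R has_real_derivative (f (- (- x)) / 2 - ?R x) * - 1) (at x)"
      by (rule DERIV_chain2) (auto intro!: derivative_eq_intros)
    then show ?thesis by simp
  qed
  have bounds: "\<bar>?L x\<bar> \<le> M / 2" "\<bar>?R x\<bar> \<le> M / 2" for x
    using abs_helmholtz_left_le[OF f] abs_helmholtz_left_le[OF f', of M] f(2) by auto
  have F: "inv_helmholtz f = (\<lambda>x. ?L x + ?R x)"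
    using inv_helmholtz_split(2)[OF f] by auto
  have G: "deriv (inv_helmholtz f) = (\<lambda>x. ?R x - ?L x)"
  proof
    fix x
    have "(inv_helmholtz f has_real_derivative ?R x - ?L x) (at x)"
      unfolding F using DERIV_add[OF L R, of x] by simp
    then show "deriv (inv_helmholtz f) x = ?R x - ?L x" by (rule DERIV_imp_deriv)
  qed
  show "(deriv (inv_helmholtz f) has_real_derivative inv_helmholtz f x - f x) (at x)"
  proof -
    have "?R x - f x / 2 - (f x / 2 - ?L x) = inv_helmholtz f x - f x" by (simp add: F)
    then show ?thesis unfolding G using DERIV_diff[OF R L, of x] by simp
  qed
  show "\<bar>inv_helmholtz f x\<bar> \<le> M" "\<bar>deriv (inv_helmholtz f) x\<bar> \<le> M"
    unfolding G unfolding F using bounds[of x] by auto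
qed

text \<open>Positivity of the kernel gives \<open>f = 0\<close> almost everywhere; the zero set of a
  continuous function is closed, and a closed set of full measure is the whole line.\<close>

lemma inv_helmholtz_eq_0_imp:
  assumes f: "continuous_on UNIV f" "\<And>y. \<bar>f y\<bar> \<le> M" and nonneg: "\<And>y. 0 \<le> f y"
    and zero: "inv_helmholtz f x = 0"
  shows "f y = 0"
proof -
  have "AE y in lborel. exp (- \<bar>x - y\<bar>) / 2 * f y = 0"
    using zero nonneg inv_helmholtz_split(1)[OF f]
    by (subst integral_nonneg_eq_0_iff_AE[symmetric]) (auto simp: inv_helmholtz_def)
  then have "AE y in lebesgue. y \<in> {y. f y = 0}"
    by (intro AE_completion) (auto elim: AE_mp)
  moreover have "closed {y. f y = 0}"
    using closed_Collect_eq[OF f(1) continuous_on_const[of UNIV 0]] .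
  ultimately show ?thesis
    using mem_closed_if_AE_lebesgue by blast
qed

section \<open>A maximum principle for transport equations\<close>

text \<open>The penalty \<open>\<eta> * sqrt (1 + x\<^sup>2)\<close> forces a maximum to be attained although the domain is unbounded.\<close>

lemma transport_maximum_principle:
  fixes W a Wt Wx :: "real \<Rightarrow> real \<Rightarrow> real"
  assumes cont: "continuous_on ({0..d} \<times> UNIV) (\<lambda>p. W (fst p) (snd p))"
    and B: "\<And>t x. t \<in> {0..d} \<Longrightarrow> W t x \<le> B"
    and Wt: "\<And>t x. t \<in> {0..d} \<Longrightarrow> ((\<lambda>t. W t x) has_real_derivative Wt t x) (at t within {0..d})"
    and Wx: "\<And>t x. t \<in> {0..d} \<Longrightarrow> (W t has_real_derivative Wx t x) (at x)"
    and transport: "\<And>t x. t \<in> {0..d} \<Longrightarrow> Wt t x + a t x * Wx t x \<le> K"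
    and a: "\<And>t x. t \<in> {0..d} \<Longrightarrow> \<bar>a t x\<bar> \<le> A" and K: "K \<ge> 0"
    and init: "\<And>x. W 0 x \<le> 0" and t: "t \<in> {0..d}"
  shows "W t x \<le> K * t"
proof -
  have A: "A \<ge> 0" using a[OF t, of x] by linarith
  \<comment> \<open>The slope of the penalty is at most \<open>\<eta>\<close>, so at a maximum the
    transport term costs at most \<open>A * \<eta>\<close>. The rate \<open>A + 1\<close> pays for
    this and leaves a surplus \<open>\<eta>\<close>, which makes the final inequality
    strict.\<close>
  have step: "W t x \<le> K * t + \<eta> * ((A + 1) * t + sqrt (1 + x\<^sup>2))" if \<eta>: "\<eta> > 0" for \<eta>
  proof (rule ccontr)
    assume contra: "\<not> ?thesis"
    define c where "c = K + \<eta> * (A + 1)"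
    have c: "c \<ge> 0" using K A \<eta> by (simp add: c_def)
    define \<Phi> where "\<Phi> s y = W s y - c * s - \<eta> * sqrt (1 + y\<^sup>2)" for s y
    have pos: "\<Phi> t x > 0" using contra by (simp add: \<Phi>_def c_def algebra_simps)
    \<comment> \<open>Beyond \<open>B / \<eta>\<close> the penalty exceeds the bound
      \<open>B\<close>, so \<open>\<Phi>\<close> is not positive there; including
      \<open>\<bar>x\<bar>\<close> keeps \<open>(t, x)\<close> inside the compact box.\<close>
    define L where "L = max \<bar>x\<bar> (B / \<eta>)"
    have outside: "\<Phi> s y \<le> 0" if "s \<in> {0..d}" "\<bar>y\<bar> > L" for s y
    proof -
      have "B / \<eta> \<le> sqrt (1 + y\<^sup>2)"
        using that(2) real_sqrt_le_mono[of "y\<^sup>2" "1 + y\<^sup>2"] by (simp add: L_def)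
      then have "B \<le> \<eta> * sqrt (1 + y\<^sup>2)" using \<eta> by (simp add: field_simps)
      moreover have "c * s \<ge> 0" using c that by simp
      ultimately show ?thesis using B[OF that(1), of y] by (simp add: \<Phi>_def)
    qed
    have "compact ({0..d} \<times> {- L..L})" by (intro compact_Times) auto
    moreover have "(t, x) \<in> {0..d} \<times> {- L..L}" using t by (auto simp: L_def)
    moreover have "continuous_on ({0..d} \<times> {- L..L}) (\<lambda>p. \<Phi> (fst p) (snd p))"
      unfolding \<Phi>_def by (intro continuous_intros continuous_on_subset[OF cont]) auto
    ultimately obtain p where p: "p \<in> {0..d} \<times> {- L..L}"
        "\<And>q. q \<in> {0..d} \<times> {- L..L} \<Longrightarrow> \<Phi> (fst q) (snd q) \<le> \<Phi> (fst p) (snd p)"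
      using continuous_attains_sup[of "{0..d} \<times> {- L..L}" "\<lambda>p. \<Phi> (fst p) (snd p)"] by auto
    define s y where "s = fst p" and "y = snd p"
    have sd: "s \<in> {0..d}" using p(1) by (auto simp: s_def)
    have top: "\<Phi> t x \<le> \<Phi> s y"
      using p(2)[of "(t, x)"] \<open>(t, x) \<in> {0..d} \<times> {- L..L}\<close> by (simp add: s_def y_def)
    have max: "\<Phi> r z \<le> \<Phi> s y" if "r \<in> {0..d}" for r z
    proof (cases "\<bar>z\<bar> \<le> L")
      case True
      then show ?thesis using p(2)[of "(r, z)"] that by (simp add: s_def y_def abs_le_iff)
    next
      case False
      then show ?thesis using outside[OF that, of z] top pos by linarith
    qed
    have s_pos: "s > 0"
    proof (rule ccontr)
      assume "\<not> s > 0"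
      then have "s = 0" using sd by simp
      moreover have "0 \<le> \<eta> * sqrt (1 + y\<^sup>2)" using \<eta> by simp
      ultimately have "\<Phi> s y \<le> 0" using init[of y] by (simp add: \<Phi>_def)
      then show False using top pos by linarith
    qed
    have root_pos: "sqrt (1 + y\<^sup>2) > 0" by (simp add: add_pos_nonneg)
    have "(\<Phi> s has_real_derivative Wx s y - \<eta> * (y / sqrt (1 + y\<^sup>2))) (at y)"
    proof -
      have "((\<lambda>y. sqrt (1 + y\<^sup>2)) has_real_derivative y / sqrt (1 + y\<^sup>2)) (at y)"
        using root_pos by (auto intro!: derivative_eq_intros simp: field_simps)
      then have "((\<lambda>y. W s y - c * s - \<eta> * sqrt (1 + y\<^sup>2)) has_real_derivative
          Wx s y - 0 - \<eta> * (y / sqrt (1 + y\<^sup>2))) (at y)"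
        by (intro DERIV_diff Wx[OF sd] DERIV_const DERIV_cmult)
      then show ?thesis unfolding \<Phi>_def[abs_def] by simp
    qed
    then have "Wx s y - \<eta> * (y / sqrt (1 + y\<^sup>2)) = 0"
      by (rule DERIV_local_max[where d = 1]) (use max[OF sd] in auto)
    then have "\<bar>Wx s y\<bar> = \<eta> * (\<bar>y\<bar> / sqrt (1 + y\<^sup>2))"
      using \<eta> root_pos by (simp add: abs_mult)
    also have "\<dots> \<le> \<eta> * 1"
    proof -
      have "\<bar>y\<bar> \<le> sqrt (1 + y\<^sup>2)" by (intro real_le_rsqrt) simp
      then show ?thesis using \<eta> root_pos by (intro mult_left_mono) auto
    qed
    finally have Wx_le: "\<bar>Wx s y\<bar> \<le> \<eta>" by simp
    have "((\<lambda>s. \<Phi> s y) has_real_derivative Wt s y - c) (at s within {0..d})"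
      unfolding \<Phi>_def by (auto intro!: derivative_eq_intros Wt[OF sd])
    \<comment> \<open>The maximum may lie at the final time \<open>d\<close>, so \<open>s\<close> is
      compared with earlier times only. This still yields a derivative that is not negative.\<close>
    moreover have "\<not> (\<exists>e>0. \<forall>h>0. s - h \<in> {0..d} \<longrightarrow> h < e \<longrightarrow> \<Phi> s y < \<Phi> (s - h) y)"
    proof
      assume "\<exists>e>0. \<forall>h>0. s - h \<in> {0..d} \<longrightarrow> h < e \<longrightarrow> \<Phi> s y < \<Phi> (s - h) y"
      then obtain e where e: "e > 0" "\<And>h. h > 0 \<Longrightarrow> s - h \<in> {0..d} \<Longrightarrow> h < e \<Longrightarrow> \<Phi> s y < \<Phi> (s - h) y"
        by blast
      define h where "h = min (e / 2) s"
      have "s - h \<in> {0..d}" using sd e(1) s_pos by (auto simp: h_def)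
      moreover have "h > 0" "h < e" using e(1) s_pos by (auto simp: h_def)
      ultimately show False using e(2)[of h] max[of "s - h" y] by force
    qed
    ultimately have "Wt s y - c \<ge> 0"
      using has_real_derivative_neg_dec_left[of "\<lambda>s. \<Phi> s y" "Wt s y - c" s "{0..d}"] by fastforce
    moreover have "a s y * Wx s y \<ge> - (A * \<eta>)"
      using mult_mono[OF a[OF sd, of y] Wx_le] A abs_ge_minus_self[of "a s y * Wx s y"] by (simp add: abs_mult)
    ultimately have "Wt s y + a s y * Wx s y \<ge> K + \<eta>"
      by (simp add: c_def algebra_simps)
    then show False using transport[OF sd, of y] \<eta> by simp
  qed
  define D where "D = (A + 1) * t + sqrt (1 + x\<^sup>2)"
  have D: "D > 0" unfolding D_def
    using A t by (intro add_nonneg_pos mult_nonneg_nonneg) (auto simp: add_pos_nonneg)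
  show ?thesis
  proof (rule field_le_epsilon)
    fix e :: real assume "e > 0"
    then show "W t x \<le> K * t + e"
      using step[of "e / D"] D by (simp add: D_def[symmetric])
  qed
qed

lemma transport_abs_bound:
  fixes W a Wt Wx :: "real \<Rightarrow> real \<Rightarrow> real"
  assumes cont: "continuous_on ({0..d} \<times> UNIV) (\<lambda>p. W (fst p) (snd p))"
    and B: "\<And>t x. t \<in> {0..d} \<Longrightarrow> \<bar>W t x\<bar> \<le> B"
    and Wt: "\<And>t x. t \<in> {0..d} \<Longrightarrow> ((\<lambda>t. W t x) has_real_derivative Wt t x) (at t within {0..d})"
    and Wx: "\<And>t x. t \<in> {0..d} \<Longrightarrow> (W t has_real_derivative Wx t x) (at x)"
    and transport: "\<And>t x. t \<in> {0..d} \<Longrightarrow> \<bar>Wt t x + a t x * Wx t x\<bar> \<le> K"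
    and a: "\<And>t x. t \<in> {0..d} \<Longrightarrow> \<bar>a t x\<bar> \<le> A"
    and init: "\<And>x. W 0 x = 0" and t: "t \<in> {0..d}"
  shows "\<bar>W t x\<bar> \<le> K * t"
proof -
  have K: "K \<ge> 0" using transport[OF t, of x] by linarith
  have "W t x \<le> K * t"
    by (rule transport_maximum_principle[OF cont _ Wt Wx _ a K _ t, where B = B])
       (use B transport init in \<open>auto simp: abs_le_iff\<close>)
  moreover have "- W t x \<le> K * t"
  proof (rule transport_maximum_principle[OF _ _ _ _ _ a K _ t, where B = B and W = "\<lambda>t x. - W t x"
        and Wt = "\<lambda>t x. - Wt t x" and Wx = "\<lambda>t x. - Wx t x"])
    show "continuous_on ({0..d} \<times> UNIV) (\<lambda>p. - W (fst p) (snd p))"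
      using cont by (rule continuous_on_minus)
    fix t x assume t: "t \<in> {0..d}"
    show "- W t x \<le> B" using B[OF t, of x] by (simp add: abs_le_iff)
    show "((\<lambda>t. - W t x) has_real_derivative - Wt t x) (at t within {0..d})"
      using Wt[OF t] by (rule DERIV_minus)
    show "((\<lambda>x. - W t x) has_real_derivative - Wx t x) (at x)"
      using Wx[OF t] by (rule DERIV_minus)
    show "- Wt t x + a t x * - Wx t x \<le> K"
      using transport[OF t, of x] by (simp add: abs_le_iff)
  qed (use init in auto)
  ultimately show ?thesis by (simp add: abs_le_iff)
qed

section \<open>Propagation of vanishing in time\<close>

lemma abs_nonlocal_source_le:
  assumes w: "\<bar>w x\<bar> \<le> B" "\<bar>deriv w x\<bar> \<le> B"
  shows "\<bar>nonlocal_source n w x\<bar> \<le>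
    real n / 2 * (B ^ (n - 1) * B\<^sup>2) + real n * (real n + 3) / (2 * (real n + 1)) * B ^ (n + 1)"
proof -
  have B: "B \<ge> 0" using w(1) by linarith
  have pw: "\<bar>w x ^ k\<bar> \<le> B ^ k" for k
    unfolding power_abs using w(1) by (intro power_mono) auto
  have dw: "(deriv w x)\<^sup>2 \<le> B\<^sup>2" using w(2) B by (simp add: abs_le_square_iff[symmetric])
  have "\<bar>nonlocal_source n w x\<bar> \<le> \<bar>real n / 2 * w x ^ (n - 1) * (deriv w x)\<^sup>2\<bar> +
      \<bar>real n * (real n + 3) / (2 * (real n + 1)) * w x ^ (n + 1)\<bar>"
    unfolding nonlocal_source_def by (rule abs_triangle_ineq)
  also have "\<bar>real n / 2 * w x ^ (n - 1) * (deriv w x)\<^sup>2\<bar> = real n / 2 * (\<bar>w x ^ (n - 1)\<bar> * (deriv w x)\<^sup>2)"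
    by (simp add: abs_mult)
  also have "\<dots> \<le> real n / 2 * (B ^ (n - 1) * B\<^sup>2)"
    using pw[of "n - 1"] dw B by (intro mult_left_mono mult_mono) auto
  also have "\<bar>real n * (real n + 3) / (2 * (real n + 1)) * w x ^ (n + 1)\<bar> =
      real n * (real n + 3) / (2 * (real n + 1)) * \<bar>w x ^ (n + 1)\<bar>"
    by (simp add: abs_mult)
  also have "\<dots> \<le> real n * (real n + 3) / (2 * (real n + 1)) * B ^ (n + 1)"
    using pw[of "n + 1"] by (intro mult_left_mono) auto
  finally show ?thesis by simp
qed

lemma continuous_on_nonlocal_source:
  assumes "continuous_on S w" "continuous_on S (deriv w)"
  shows "continuous_on S (nonlocal_source n w)"
  unfolding nonlocal_source_def[abs_def] using assms by (intro continuous_intros)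

text \<open>For odd \<open>n\<close> the exponents \<open>n - 1\<close> and \<open>n + 1\<close> are
  even.\<close>

lemma nonlocal_source_nonneg:
  assumes "odd n"
  shows "0 \<le> nonlocal_source n w x"
proof -
  have "0 \<le> w x ^ (n - 1)" "0 \<le> w x ^ (n + 1)"
    using assms by (intro zero_le_even_power; simp)+
  then show ?thesis
    unfolding nonlocal_source_def by (intro add_nonneg_nonneg mult_nonneg_nonneg) auto
qed

text \<open>Two nonnegative terms with sum \<open>0\<close> both vanish, and the coefficient of the
  pure power is nonzero because an odd \<open>n\<close> is positive.\<close>

lemma nonlocal_source_eq_0_imp:
  assumes n: "odd n" and zero: "nonlocal_source n w x = 0"
  shows "w x = 0"
proof -
  have "0 \<le> w x ^ (n - 1)" "0 \<le> w x ^ (n + 1)"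
    using n by (intro zero_le_even_power; simp)+
  then have "0 \<le> real n / 2 * w x ^ (n - 1) * (deriv w x)\<^sup>2"
    "0 \<le> real n * (real n + 3) / (2 * (real n + 1)) * w x ^ (n + 1)"
    by (intro mult_nonneg_nonneg; simp)+
  then have "real n * (real n + 3) / (2 * (real n + 1)) * w x ^ (n + 1) = 0"
    using zero unfolding nonlocal_source_def by linarith
  moreover have "real n * (real n + 3) / (2 * (real n + 1)) \<noteq> 0"
    using n by (auto elim: oddE)
  ultimately show ?thesis by simp
qed

definition source_const :: "nat \<Rightarrow> real" where
  "source_const n = real n / 2 + real n * (real n + 3) / (2 * (real n + 1))"

lemma source_const_nonneg: "source_const n \<ge> 0"
  by (simp add: source_const_def)

text \<open>For \<open>m \<le> 1\<close> each of the two monomials is at most \<open>m\<close>. A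
  bound linear in \<open>m\<close> is all that the halving argument asks for.\<close>

lemma abs_nonlocal_source_le_small:
  assumes w: "\<bar>w x\<bar> \<le> m" "\<bar>deriv w x\<bar> \<le> m" and m: "m \<le> 1"
  shows "\<bar>nonlocal_source n w x\<bar> \<le> source_const n * m"
proof -
  have m0: "m \<ge> 0" using w(1) by linarith
  have "m ^ (n - 1) * m\<^sup>2 \<le> 1 * m"
    using m m0 by (intro mult_mono) (auto simp: power_le_one power2_eq_square mult_left_le)
  moreover have "m ^ (n + 1) \<le> m"
    using m m0 by (simp add: mult_left_le power_le_one)
  ultimately have "real n / 2 * (m ^ (n - 1) * m\<^sup>2) + real n * (real n + 3) / (2 * (real n + 1)) * m ^ (n + 1) \<le>
     real n / 2 * m + real n * (real n + 3) / (2 * (real n + 1)) * m"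
    by (intro add_mono mult_left_mono) auto
  also have "\<dots> = source_const n * m" by (simp add: source_const_def algebra_simps)
  finally show ?thesis using abs_nonlocal_source_le[of w x m n] w by linarith
qed

text \<open>\<open>\<sigma> = - 1\<close> is the equation with time reversed. The spatial difference quotients of \<open>u\<close>, unlike
  \<open>u\<^sub>x\<close>, are classical solutions of a transport equation, so that no second derivative is needed.\<close>

lemma small_solution_halving:
  fixes u :: "real \<Rightarrow> real \<Rightarrow> real" and \<sigma> d m :: real
  assumes \<sigma>: "\<bar>\<sigma>\<bar> = 1"
    and ux: "\<And>t x. t \<in> {0..d} \<Longrightarrow> (u t has_real_derivative deriv (u t) x) (at x)"
    and uxc: "\<And>t. t \<in> {0..d} \<Longrightarrow> continuous_on UNIV (deriv (u t))"
    and cont: "continuous_on ({0..d} \<times> UNIV) (\<lambda>p. u (fst p) (snd p))"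
    and eq: "\<And>t x. t \<in> {0..d} \<Longrightarrow> ((\<lambda>t. u t x) has_real_derivative
        \<sigma> * - (u t x ^ n * deriv (u t) x + deriv (inv_helmholtz (nonlocal_source n (u t))) x)) (at t within {0..d})"
    and init: "\<And>x. u 0 x = 0"
    and d: "(real n + 2 * source_const n) * d \<le> 1 / 2"
    and m: "m \<le> 1"
    and small: "\<And>t x. t \<in> {0..d} \<Longrightarrow> \<bar>u t x\<bar> \<le> m" "\<And>t x. t \<in> {0..d} \<Longrightarrow> \<bar>deriv (u t) x\<bar> \<le> m"
    and t: "t \<in> {0..d}"
  shows "\<bar>u t x\<bar> \<le> m / 2" and "\<bar>deriv (u t) x\<bar> \<le> m / 2"
proof -
  have m0: "m \<ge> 0" using small(1)[OF t, of x] by linarith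
  define c where "c = source_const n"
  have c: "c \<ge> 0" by (simp add: c_def source_const_nonneg)
  define G where "G t = deriv (inv_helmholtz (nonlocal_source n (u t)))" for t
  have uc: "continuous_on UNIV (u t)" if "t \<in> {0..d}" for t
    using DERIV_continuous_on[of UNIV "u t" "deriv (u t)"] ux[OF that] by (auto intro: has_field_derivative_at_within)
  have f: "continuous_on UNIV (nonlocal_source n (u t))" "\<bar>nonlocal_source n (u t) y\<bar> \<le> c * m" if "t \<in> {0..d}" for t y
    using continuous_on_nonlocal_source[OF uc uxc] abs_nonlocal_source_le_small small m that unfolding c_def by blast+
  have G: "\<bar>G t y\<bar> \<le> c * m" if "t \<in> {0..d}" for t y
    unfolding G_def by (rule deriv_inv_helmholtz(3)[OF f[OF that]])
  \<comment> \<open>The derivative of \<open>G t\<close> is the inverse Helmholtz transform of the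
    source minus the source, each at most \<open>c * m\<close>; this is the origin of the factor
    \<open>2\<close> in the condition on \<open>d\<close>.\<close>
  have G_lip: "\<bar>G t y - G t z\<bar> \<le> 2 * (c * m) * \<bar>y - z\<bar>" if t: "t \<in> {0..d}" for t y z
  proof -
    have "\<bar>inv_helmholtz (nonlocal_source n (u t)) y - nonlocal_source n (u t) y\<bar> \<le> 2 * (c * m)" for y
      using deriv_inv_helmholtz(2)[OF f[OF t], of y] f(2)[OF t, of y] by linarith
    then show ?thesis
      using field_differentiable_bound[of UNIV "G t"
          "\<lambda>y. inv_helmholtz (nonlocal_source n (u t)) y - nonlocal_source n (u t) y" "2 * (c * m)" y z]
        deriv_inv_helmholtz(1)[OF f[OF t]] unfolding G_def by simp
  qed
  have un_lip: "\<bar>u t y ^ n - u t z ^ n\<bar> \<le> real n * m * \<bar>y - z\<bar>" if t: "t \<in> {0..d}" for t y z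
  proof -
    have "((\<lambda>y. u t y ^ n) has_real_derivative real n * u t y ^ (n - 1) * deriv (u t) y) (at y)" for y
      by (auto intro!: derivative_eq_intros ux[OF t])
    moreover have "\<bar>real n * u t y ^ (n - 1) * deriv (u t) y\<bar> \<le> real n * m" for y
    proof -
      have "\<bar>u t y ^ (n - 1)\<bar> \<le> 1"
        unfolding power_abs using small(1)[OF t, of y] m by (intro power_le_one) auto
      then have "\<bar>u t y ^ (n - 1)\<bar> * \<bar>deriv (u t) y\<bar> \<le> 1 * m"
        using small(2)[OF t, of y] m0 by (intro mult_mono) auto
      then have "real n * (\<bar>u t y ^ (n - 1)\<bar> * \<bar>deriv (u t) y\<bar>) \<le> real n * m"
        by (intro mult_left_mono) auto
      then show ?thesis by (simp add: abs_mult mult.assoc)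
    qed
    ultimately show ?thesis
      using field_differentiable_bound[of UNIV "\<lambda>y. u t y ^ n"
          "\<lambda>y. real n * u t y ^ (n - 1) * deriv (u t) y" "real n * m" y z] by simp
  qed
  have a: "\<bar>\<sigma> * u t y ^ n\<bar> \<le> 1" if "t \<in> {0..d}" for t y
    unfolding abs_mult \<sigma> power_abs using small(1)[OF that, of y] m by (auto intro!: power_le_one)
  \<comment> \<open>The maximum principle yields bounds \<open>K * t\<close>, and the condition on
    \<open>d\<close> is chosen to turn them into \<open>m / 2\<close>. The largest \<open>K\<close>
    is the one for the difference quotients.\<close>
  have md: "K * t \<le> m / 2" if "K \<le> (real n + 2 * c) * m" for K
  proof -
    have "K * t \<le> ((real n + 2 * c) * m) * t" using that t by (intro mult_right_mono) auto
    also have "\<dots> \<le> ((real n + 2 * c) * m) * d" using t c m0 by (intro mult_left_mono) auto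
    also have "\<dots> = ((real n + 2 * c) * d) * m" by (simp add: algebra_simps)
    also have "\<dots> \<le> 1 / 2 * m" using d m0 unfolding c_def by (intro mult_right_mono) auto
    finally show ?thesis by simp
  qed
  have "\<bar>u t x\<bar> \<le> c * m * t"
  proof (rule transport_abs_bound[OF cont small(1) eq ux _ a init t])
    fix t x assume t: "t \<in> {0..d}"
    have "\<sigma> * - (u t x ^ n * deriv (u t) x + G t x) + \<sigma> * u t x ^ n * deriv (u t) x = - \<sigma> * G t x"
      by (simp add: algebra_simps)
    then show "\<bar>\<sigma> * - (u t x ^ n * deriv (u t) x + deriv (inv_helmholtz (nonlocal_source n (u t))) x)
        + \<sigma> * u t x ^ n * deriv (u t) x\<bar> \<le> c * m"
      using G[OF t, of x] \<sigma> unfolding G_def by (simp add: abs_mult)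
  qed
  also have "\<dots> \<le> m / 2" by (rule md) (use c m0 in \<open>auto intro!: mult_right_mono\<close>)
  finally show "\<bar>u t x\<bar> \<le> m / 2" .
  have quot: "\<bar>(u t (x + k) - u t x) / k\<bar> \<le> m / 2" if k: "k > 0" for k
  proof -
    have "\<bar>(u t (x + k) - u t x) / k\<bar> \<le> (real n + 2 * c) * m * t"
    \<comment> \<open>The a priori bound \<open>2 / k\<close> blows up as \<open>k\<close> tends to
      \<open>0\<close>, but it does not enter the conclusion of the maximum principle, which is
      therefore uniform in \<open>k\<close>.\<close>
    proof (rule transport_abs_bound[OF _ _ _ _ _ a _ t, where W = "\<lambda>t x. (u t (x + k) - u t x) / k" and B = "2 / k"
        and Wt = "\<lambda>t x. (\<sigma> * - (u t (x + k) ^ n * deriv (u t) (x + k) + G t (x + k)) -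
                       \<sigma> * - (u t x ^ n * deriv (u t) x + G t x)) / k"
        and Wx = "\<lambda>t x. (deriv (u t) (x + k) - deriv (u t) x) / k"])
      have "continuous_on ({0..d} \<times> UNIV) (\<lambda>p. (fst p, snd p + k))"
        by (intro continuous_intros)
      then have "continuous_on ({0..d} \<times> UNIV) (\<lambda>p. u (fst p) (snd p + k))"
        using continuous_on_compose2[OF cont, of "{0..d} \<times> UNIV" "\<lambda>p. (fst p, snd p + k)"] by fastforce
      then show "continuous_on ({0..d} \<times> UNIV) (\<lambda>p. (u (fst p) (snd p + k) - u (fst p) (snd p)) / k)"
        using k by (intro continuous_on_divide continuous_on_diff cont continuous_on_const) auto
      show "(u 0 (x + k) - u 0 x) / k = 0" for x by (simp add: init)
      fix t x assume t: "t \<in> {0..d}"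
      have "\<bar>u t (x + k) - u t x\<bar> \<le> 2"
        using small(1)[OF t, of x] small(1)[OF t, of "x + k"] m by linarith
      then show "\<bar>(u t (x + k) - u t x) / k\<bar> \<le> 2 / k"
        using k by (simp add: abs_divide divide_right_mono)
      show "((\<lambda>t. (u t (x + k) - u t x) / k) has_real_derivative
          (\<sigma> * - (u t (x + k) ^ n * deriv (u t) (x + k) + G t (x + k)) -
           \<sigma> * - (u t x ^ n * deriv (u t) x + G t x)) / k) (at t within {0..d})"
        unfolding G_def by (intro DERIV_cdivide DERIV_diff eq t)
      have "((\<lambda>x. u t (x + k)) has_real_derivative deriv (u t) (x + k)) (at x)"
        using ux[OF t, of "x + k"] by (simp add: DERIV_shift)
      then show "((\<lambda>x. (u t (x + k) - u t x) / k) has_real_derivative (deriv (u t) (x + k) - deriv (u t) x) / k) (at x)"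
        by (intro DERIV_cdivide DERIV_diff ux t)
      \<comment> \<open>The equation at \<open>x\<close> is subtracted from the one at
        \<open>x + k\<close>. Splitting the difference of the products so that the increment of the
        derivative is multiplied by \<open>u t x ^ n\<close> isolates the transport term;
        \<open>?E\<close> is the rest, of size \<open>k * m\<close>.\<close>
      let ?E = "(u t (x + k) ^ n - u t x ^ n) * deriv (u t) (x + k) + (G t (x + k) - G t x)"
      have "(\<sigma> * - (u t (x + k) ^ n * deriv (u t) (x + k) + G t (x + k)) -
           \<sigma> * - (u t x ^ n * deriv (u t) x + G t x)) / k +
          \<sigma> * u t x ^ n * ((deriv (u t) (x + k) - deriv (u t) x) / k) = - \<sigma> * ?E / k"
        using k by (simp add: field_simps)
      moreover have "\<bar>- \<sigma> * ?E / k\<bar> \<le> (real n + 2 * c) * m"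
      proof -
        have "\<bar>(u t (x + k) ^ n - u t x ^ n) * deriv (u t) (x + k)\<bar> \<le> (real n * m * k) * 1"
          unfolding abs_mult using un_lip[OF t, of "x + k" x] small(2)[OF t, of "x + k"] m m0 k
          by (intro mult_mono) auto
        moreover have "\<bar>G t (x + k) - G t x\<bar> \<le> 2 * (c * m) * k"
          using G_lip[OF t, of "x + k" x] k by simp
        ultimately have "\<bar>?E\<bar> \<le> (real n + 2 * c) * m * k" by (simp add: algebra_simps)
        moreover have "\<bar>- \<sigma> * ?E / k\<bar> = \<bar>?E\<bar> / k"
          using k \<sigma> by (simp add: abs_mult abs_divide)
        ultimately show ?thesis using k by (simp add: pos_divide_le_eq)
      qed
      ultimately show "\<bar>(\<sigma> * - (u t (x + k) ^ n * deriv (u t) (x + k) + G t (x + k)) -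
           \<sigma> * - (u t x ^ n * deriv (u t) x + G t x)) / k +
          \<sigma> * u t x ^ n * ((deriv (u t) (x + k) - deriv (u t) x) / k)\<bar> \<le> (real n + 2 * c) * m"
        by simp
    qed
    also have "\<dots> \<le> m / 2" by (rule md) simp
    finally show ?thesis .
  qed
  show "\<bar>deriv (u t) x\<bar> \<le> m / 2"
  proof (rule tendsto_upperbound)
    have "((\<lambda>k. (u t (x + k) - u t x) / k) \<longlongrightarrow> deriv (u t) x) (at 0)"
      using ux[OF t, of x] by (simp add: DERIV_def)
    then have "((\<lambda>k. (u t (x + k) - u t x) / k) \<longlongrightarrow> deriv (u t) x) (at_right 0)"
      by (rule filterlim_mono) (auto simp: at_le)
    then show "((\<lambda>k. \<bar>(u t (x + k) - u t x) / k\<bar>) \<longlongrightarrow> \<bar>deriv (u t) x\<bar>) (at_right 0)"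
      by (rule tendsto_rabs)
    show "eventually (\<lambda>k. \<bar>(u t (x + k) - u t x) / k\<bar> \<le> m / 2) (at_right 0)"
      using eventually_at_right_less[of 0] by eventually_elim (rule quot)
  qed simp
qed

text \<open>Each use of \<open>small_solution_halving\<close> covers the whole interval
  \<open>{0..d}\<close>, so it can be iterated without loss of time: the bounds
  \<open>(1 / 2) ^ k\<close> hold there for every \<open>k\<close>.\<close>

lemma vanishing_persists:
  fixes u :: "real \<Rightarrow> real \<Rightarrow> real" and \<sigma> d :: real
  assumes \<sigma>: "\<bar>\<sigma>\<bar> = 1"
    and ux: "\<And>t x. t \<in> {0..d} \<Longrightarrow> (u t has_real_derivative deriv (u t) x) (at x)"
    and uxc: "\<And>t. t \<in> {0..d} \<Longrightarrow> continuous_on UNIV (deriv (u t))"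
    and cont: "continuous_on ({0..d} \<times> UNIV) (\<lambda>p. u (fst p) (snd p))"
    and eq: "\<And>t x. t \<in> {0..d} \<Longrightarrow> ((\<lambda>t. u t x) has_real_derivative
        \<sigma> * - (u t x ^ n * deriv (u t) x + deriv (inv_helmholtz (nonlocal_source n (u t))) x)) (at t within {0..d})"
    and init: "\<And>x. u 0 x = 0"
    and d: "(real n + 2 * source_const n) * d \<le> 1 / 2"
    and small: "\<And>t x. t \<in> {0..d} \<Longrightarrow> \<bar>u t x\<bar> \<le> 1" "\<And>t x. t \<in> {0..d} \<Longrightarrow> \<bar>deriv (u t) x\<bar> \<le> 1"
    and t: "t \<in> {0..d}"
  shows "u t x = 0"
proof -
  have "\<forall>t\<in>{0..d}. \<forall>x. \<bar>u t x\<bar> \<le> (1 / 2) ^ k \<and> \<bar>deriv (u t) x\<bar> \<le> (1 / 2) ^ k" for k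
  proof (induction k)
    case 0
    then show ?case using small by simp
  next
    case (Suc k)
    have "(1 / 2) ^ k \<le> (1 :: real)" by (intro power_le_one) auto
    note step = small_solution_halving[OF \<sigma> ux uxc cont eq init d this]
    show ?case using step Suc.IH by simp
  qed
  then have "\<bar>u t x\<bar> \<le> (1 / 2) ^ k" for k using t by blast
  moreover have "(\<lambda>k. (1 / 2 :: real) ^ k) \<longlonglongrightarrow> 0" by (intro LIMSEQ_power_zero) simp
  ultimately have "\<bar>u t x\<bar> \<le> 0" by (intro LIMSEQ_le_const[of _ 0]) auto
  then show ?thesis by simp
qed

section \<open>Classical regularity of solutions and vanishing of whole time slices\<close>

lemma continuous_on_Times_of_uniform:
  fixes u :: "real \<Rightarrow> real \<Rightarrow> real"
  assumes cont: "\<And>t. t \<in> S \<Longrightarrow> continuous_on UNIV (u t)"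
    and unif: "\<And>t e. t \<in> S \<Longrightarrow> e > 0 \<Longrightarrow> eventually (\<lambda>\<tau>. \<forall>x. \<bar>u \<tau> x - u t x\<bar> < e) (at t within S)"
  shows "continuous_on (S \<times> UNIV) (\<lambda>p. u (fst p) (snd p))"
  unfolding continuous_on_iff
proof (intro ballI allI impI)
  fix p :: "real \<times> real" and e :: real assume p: "p \<in> S \<times> UNIV" and e: "e > 0"
  define t x where "t = fst p" and "x = snd p"
  have t: "t \<in> S" using p by (auto simp: t_def)
  obtain d1 where d1: "d1 > 0" "\<And>\<tau>. \<tau> \<in> S \<Longrightarrow> \<tau> \<noteq> t \<Longrightarrow> dist \<tau> t < d1 \<Longrightarrow> \<forall>x. \<bar>u \<tau> x - u t x\<bar> < e / 2"
    using unif[OF t, of "e / 2"] e unfolding eventually_at by auto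
  obtain d2 where d2: "d2 > 0" "\<And>y. dist y x < d2 \<Longrightarrow> dist (u t y) (u t x) < e / 2"
    using cont[OF t] e unfolding continuous_on_iff by (meson UNIV_I half_gt_zero)
  show "\<exists>d>0. \<forall>q\<in>S \<times> UNIV. dist q p < d \<longrightarrow> dist (u (fst q) (snd q)) (u (fst p) (snd p)) < e"
  proof (intro exI[of _ "min d1 d2"] conjI ballI impI)
    show "min d1 d2 > 0" using d1 d2 by simp
    fix q assume q: "q \<in> S \<times> (UNIV :: real set)" "dist q p < min d1 d2"
    have d: "dist (fst q) t < d1" "dist (snd q) x < d2"
      using q(2) dist_fst_le[of q p] dist_snd_le[of q p] by (auto simp: t_def x_def)
    have "\<bar>u (fst q) (snd q) - u t (snd q)\<bar> < e / 2"
      using d1(2)[of "fst q"] d(1) q(1) e by (cases "fst q = t") auto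
    moreover have "\<bar>u t (snd q) - u t x\<bar> < e / 2"
      using d2(2)[OF d(2)] by (simp add: dist_real_def)
    ultimately have "\<bar>u (fst q) (snd q) - u t x\<bar> < e" by linarith
    then show "dist (u (fst q) (snd q)) (u (fst p) (snd p)) < e"
      by (simp add: dist_real_def t_def x_def)
  qed
qed

text \<open>Convergence in Sobolev norm becomes uniform convergence by applying the embeddings to
  differences: at exponent \<open>s\<close> to increments of \<open>u\<close> in time, and at
  exponent \<open>s - 1 > 1 / 2\<close> to the error of the difference quotient in time.\<close>

lemma is_solution_imp_classical:
  fixes u :: "real \<Rightarrow> real \<Rightarrow> real"
  assumes s: "s > 3 / 2" and sol: "is_solution n s T u" and t: "t \<in> {0..<T}"
  shows "(u t has_real_derivative deriv (u t) x) (at x)"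
    and "continuous_on UNIV (deriv (u t))"
    and "\<exists>B. \<forall>x. \<bar>u t x\<bar> \<le> B \<and> \<bar>deriv (u t) x\<bar> \<le> B"
    and "e > 0 \<Longrightarrow> eventually (\<lambda>\<tau>. \<forall>x. \<bar>u \<tau> x - u t x\<bar> < e \<and> \<bar>deriv (u \<tau>) x - deriv (u t) x\<bar> < e) (at t within {0..<T})"
    and "((\<lambda>t. u t x) has_real_derivative
        - (u t x ^ n * deriv (u t) x + deriv (inv_helmholtz (nonlocal_source n (u t))) x)) (at t within {0..<T})"
proof -
  have uc: "continuous_on UNIV (u t)" if "t \<in> {0..<T}" for t
    using sol that by (simp add: is_solution_def)
  have us: "u t \<in> sobolev s" if "t \<in> {0..<T}" for t
    using sol that by (simp add: is_solution_def C0_sobolev_def)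
  obtain v where v: "C1_sobolev_with_derivative T (s - 1) u v"
      and v_eq: "\<And>t. t \<in> {0..<T} \<Longrightarrow> AE x in lborel. v t x + u t x ^ n * deriv (u t) x
            + deriv (inv_helmholtz (nonlocal_source n (u t))) x = 0"
    using sol by (auto simp: is_solution_def)
  have us1: "u t \<in> sobolev (s - 1)" "v t \<in> sobolev (s - 1)" if "t \<in> {0..<T}" for t
    using v that by (auto simp: C1_sobolev_with_derivative_def C0_sobolev_def)
  obtain C0 where C0: "C0 \<ge> 0" "\<And>h c x. h \<in> sobolev s \<Longrightarrow> continuous_on UNIV c \<Longrightarrow> AE x in lborel. h x = c x \<Longrightarrow>
       \<bar>c x\<bar> \<le> C0 * sobolev_norm s h"
    by (rule sobolev_sup_bound[of s]) (use s in auto)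
  obtain C1 where C1: "C1 \<ge> 0" "\<And>h. h \<in> sobolev s \<Longrightarrow> continuous_on UNIV h \<Longrightarrow>
       (\<forall>x. (h has_real_derivative deriv h x) (at x)) \<and> continuous_on UNIV (deriv h) \<and>
       (\<forall>x. \<bar>deriv h x\<bar> \<le> C1 * sobolev_norm s h)"
    using sobolev_C1_bound[OF s] by blast
  obtain C2 where C2: "C2 \<ge> 0" "\<And>h c x. h \<in> sobolev (s - 1) \<Longrightarrow> continuous_on UNIV c \<Longrightarrow> AE x in lborel. h x = c x \<Longrightarrow>
       \<bar>c x\<bar> \<le> C2 * sobolev_norm (s - 1) h"
    by (rule sobolev_sup_bound[of "s - 1"]) (use s in auto)
  have ux: "(u t has_real_derivative deriv (u t) x) (at x)" if "t \<in> {0..<T}" for t x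
    using C1(2)[OF us uc] that by blast
  have uxc: "continuous_on UNIV (deriv (u t))" if "t \<in> {0..<T}" for t
    using C1(2)[OF us uc] that by blast
  show "(u t has_real_derivative deriv (u t) x) (at x)" by (rule ux[OF t])
  show "continuous_on UNIV (deriv (u t))" by (rule uxc[OF t])
  define B where "B = (C0 + C1) * sobolev_norm s (u t)"
  have B: "\<bar>u t x\<bar> \<le> B" "\<bar>deriv (u t) x\<bar> \<le> B" for x
  proof -
    have "\<bar>u t x\<bar> \<le> C0 * sobolev_norm s (u t)" using C0(2)[OF us uc] t by simp
    moreover have "\<bar>deriv (u t) x\<bar> \<le> C1 * sobolev_norm s (u t)" using C1(2)[OF us uc] t by blast
    moreover have "C0 * sobolev_norm s (u t) \<le> B" "C1 * sobolev_norm s (u t) \<le> B"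
      using C0(1) C1(1) sobolev_norm_nonneg by (auto simp: B_def distrib_right)
    ultimately show "\<bar>u t x\<bar> \<le> B" "\<bar>deriv (u t) x\<bar> \<le> B" by linarith+
  qed
  then show "\<exists>B. \<forall>x. \<bar>u t x\<bar> \<le> B \<and> \<bar>deriv (u t) x\<bar> \<le> B" by blast
  have within: "eventually (\<lambda>\<tau>. \<tau> \<in> {0..<T} \<and> \<tau> \<noteq> t) (at t within {0..<T})"
    unfolding eventually_at by (intro exI[of _ 1]) auto
  show "eventually (\<lambda>\<tau>. \<forall>x. \<bar>u \<tau> x - u t x\<bar> < e \<and> \<bar>deriv (u \<tau>) x - deriv (u t) x\<bar> < e) (at t within {0..<T})"
    if e: "e > 0"
  proof -
    have "((\<lambda>\<tau>. sobolev_norm s (\<lambda>x. u \<tau> x - u t x)) \<longlongrightarrow> 0) (at t within {0..<T})"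
      using sol t by (simp add: is_solution_def C0_sobolev_def)
    then have "((\<lambda>\<tau>. (C0 + C1) * sobolev_norm s (\<lambda>x. u \<tau> x - u t x)) \<longlongrightarrow> 0) (at t within {0..<T})"
      by (rule tendsto_mult_right_zero)
    then have "eventually (\<lambda>\<tau>. (C0 + C1) * sobolev_norm s (\<lambda>x. u \<tau> x - u t x) < e) (at t within {0..<T})"
      using e by (rule order_tendstoD(2))
    with within show ?thesis
    proof eventually_elim
      case (elim \<tau>)
      let ?h = "\<lambda>x. u \<tau> x - u t x"
      have \<tau>: "\<tau> \<in> {0..<T}" using elim by simp
      have h: "?h \<in> sobolev s" using sobolev_lincomb[OF us[OF \<tau>] us[OF t], of 1 "-1"] by simp
      have hc: "continuous_on UNIV ?h" by (intro continuous_intros uc \<tau> t)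
      have small: "C0 * sobolev_norm s ?h < e" "C1 * sobolev_norm s ?h < e"
        using elim C0(1) C1(1) mult_nonneg_nonneg[OF C0(1) sobolev_norm_nonneg[of s ?h]]
          mult_nonneg_nonneg[OF C1(1) sobolev_norm_nonneg[of s ?h]] by (auto simp: distrib_right)
      have "deriv ?h x = deriv (u \<tau>) x - deriv (u t) x" for x
        by (intro DERIV_imp_deriv DERIV_diff ux \<tau> t)
      moreover have "\<bar>deriv ?h x\<bar> < e" for x
        using C1(2)[OF h hc] small(2) le_less_trans by blast
      moreover have "\<bar>?h x\<bar> < e" for x
        using C0(2)[OF h hc, of x] small(1) by simp
      ultimately show ?case by simp
    qed
  qed
  \<comment> \<open>By the equation \<open>- G\<close> is a continuous representative of
    \<open>v t\<close>. It replaces \<open>v t\<close> in the sup bound, so the quotients converge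
    at every \<open>x\<close>.\<close>
  define G where "G = (\<lambda>x. u t x ^ n * deriv (u t) x + deriv (inv_helmholtz (nonlocal_source n (u t))) x)"
  have src: "continuous_on UNIV (nonlocal_source n (u t))"
    by (rule continuous_on_nonlocal_source[OF uc[OF t] uxc[OF t]])
  have "continuous_on UNIV (deriv (inv_helmholtz (nonlocal_source n (u t))))"
    using deriv_inv_helmholtz(1)[OF src abs_nonlocal_source_le[where n = n, OF B]]
    by (intro DERIV_continuous_on[of UNIV]) (auto intro: has_field_derivative_at_within)
  then have Gc: "continuous_on UNIV G"
    unfolding G_def using uc[OF t] uxc[OF t] by (intro continuous_intros)
  have "((\<lambda>\<tau>. (u \<tau> x - u t x) / (\<tau> - t) + G x) \<longlongrightarrow> 0) (at t within {0..<T})"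
  proof (rule Lim_null_comparison)
    have "((\<lambda>\<tau>. sobolev_norm (s - 1) (\<lambda>x. (u \<tau> x - u t x) / (\<tau> - t) - v t x)) \<longlongrightarrow> 0) (at t within {0..<T})"
      using v t by (simp add: C1_sobolev_with_derivative_def)
    then show "((\<lambda>\<tau>. C2 * sobolev_norm (s - 1) (\<lambda>x. (u \<tau> x - u t x) / (\<tau> - t) - v t x)) \<longlongrightarrow> 0) (at t within {0..<T})"
      by (rule tendsto_mult_right_zero)
    show "eventually (\<lambda>\<tau>. norm ((u \<tau> x - u t x) / (\<tau> - t) + G x) \<le>
        C2 * sobolev_norm (s - 1) (\<lambda>x. (u \<tau> x - u t x) / (\<tau> - t) - v t x)) (at t within {0..<T})"
      using within
    proof eventually_elim
      case (elim \<tau>)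
      then have \<tau>: "\<tau> \<in> {0..<T}" by simp
      have "(\<lambda>x. 1 / (\<tau> - t) * (1 * u \<tau> x + - 1 * u t x) + - 1 * v t x) \<in> sobolev (s - 1)"
        by (intro sobolev_lincomb us1 \<tau> t)
      then have "(\<lambda>x. (u \<tau> x - u t x) / (\<tau> - t) - v t x) \<in> sobolev (s - 1)" by simp
      moreover have "continuous_on UNIV (\<lambda>x. (u \<tau> x - u t x) / (\<tau> - t) + G x)"
        using elim by (intro continuous_intros uc \<tau> t Gc) auto
      moreover have "AE x in lborel. (u \<tau> x - u t x) / (\<tau> - t) - v t x = (u \<tau> x - u t x) / (\<tau> - t) + G x"
        using v_eq[OF t] by eventually_elim (simp add: G_def)
      ultimately show ?case unfolding real_norm_def by (rule C2(2))
    qed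
  qed
  then have "((\<lambda>\<tau>. (u \<tau> x - u t x) / (\<tau> - t) + G x - G x) \<longlongrightarrow> 0 - G x) (at t within {0..<T})"
    by (intro tendsto_diff tendsto_const)
  then show "((\<lambda>t. u t x) has_real_derivative
        - (u t x ^ n * deriv (u t) x + deriv (inv_helmholtz (nonlocal_source n (u t))) x)) (at t within {0..<T})"
    by (simp add: has_field_derivative_iff G_def)
qed

lemma vanishes_at_rectangle_time:
  fixes u :: "real \<Rightarrow> real \<Rightarrow> real"
  assumes n: "odd n" and s: "s > 3 / 2" and sol: "is_solution n s T u"
    and t: "t \<in> {t0<..<t1}" and sub: "{t0<..<t1} \<subseteq> {0..<T}" and "x0 < x1"
    and zero: "\<And>t x. t \<in> {t0<..<t1} \<Longrightarrow> x \<in> {x0<..<x1} \<Longrightarrow> u t x = 0"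
  shows "u t x = 0"
proof -
  have tT: "t \<in> {0..<T}" using t sub by blast
  note classical = is_solution_imp_classical[OF s sol tT]
  define f where "f = nonlocal_source n (u t)"
  obtain B where B: "\<And>x. \<bar>u t x\<bar> \<le> B" "\<And>x. \<bar>deriv (u t) x\<bar> \<le> B" using classical(3) by blast
  have uc: "continuous_on UNIV (u t)"
    using sol tT by (simp add: is_solution_def)
  have fc: "continuous_on UNIV f"
    unfolding f_def by (rule continuous_on_nonlocal_source[OF uc classical(2)])
  note f = fc abs_nonlocal_source_le[where n = n, OF B, folded f_def]
  have ux0: "deriv (u t) y = 0" if "y \<in> {x0<..<x1}" for y
  proof -
    have "(u t has_real_derivative 0) (at y)"
      by (rule has_field_derivative_transform_within_open[OF DERIV_const[of 0], of "{x0<..<x1}"])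
         (use that zero[OF t] in auto)
    then show ?thesis by (rule DERIV_imp_deriv)
  qed
  have G0: "deriv (inv_helmholtz f) y = 0" if y: "y \<in> {x0<..<x1}" for y
  proof -
    \<comment> \<open>The open time interval of the rectangle makes the derivative two-sided at
      \<open>t\<close>, so it can be compared with that of the constant \<open>0\<close>.\<close>
    have "((\<lambda>t. u t y) has_real_derivative
        - (u t y ^ n * deriv (u t) y + deriv (inv_helmholtz f) y)) (at t within {t0<..<t1})"
      unfolding f_def by (rule has_field_derivative_subset[OF classical(5) sub])
    then have "((\<lambda>t. u t y) has_real_derivative - (u t y ^ n * deriv (u t) y + deriv (inv_helmholtz f) y)) (at t)"
      by (simp only: at_within_open[OF t open_greaterThanLessThan])
    moreover have "((\<lambda>t. u t y) has_real_derivative 0) (at t)"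
      by (rule has_field_derivative_transform_within_open[OF DERIV_const[of 0], of "{t0<..<t1}"])
         (use t y zero in auto)
    ultimately have "- (u t y ^ n * deriv (u t) y + deriv (inv_helmholtz f) y) = 0"
      by (rule DERIV_unique)
    then show ?thesis using ux0[OF y] by simp
  qed
  define y where "y = (x0 + x1) / 2"
  have y: "y \<in> {x0<..<x1}" using \<open>x0 < x1\<close> by (auto simp: y_def)
  have "(deriv (inv_helmholtz f) has_real_derivative 0) (at y)"
    by (rule has_field_derivative_transform_within_open[OF DERIV_const[of 0], of "{x0<..<x1}"])
       (use y G0 in auto)
  then have "inv_helmholtz f y - f y = 0"
    using deriv_inv_helmholtz(1)[OF f, of y] by (rule DERIV_unique[rotated])
  moreover have "f y = 0"
    using ux0[OF y] zero[OF t y] by (simp add: f_def nonlocal_source_def)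
  ultimately have "inv_helmholtz f y = 0" by simp
  then have "f x = 0"
    by (rule inv_helmholtz_eq_0_imp[OF f, rotated]) (simp add: f_def nonlocal_source_nonneg[OF n])
  then show ?thesis
    unfolding f_def by (rule nonlocal_source_eq_0_imp[OF n])
qed

text \<open>The curve is reparametrised as \<open>t + \<sigma> * r\<close> with
  \<open>r \<ge> 0\<close>, where the sign \<open>\<sigma>\<close> is the direction from
  \<open>t\<close> to the target time; so one lemma starting at time \<open>0\<close> covers both
  directions.\<close>

lemma vanishing_near:
  fixes u :: "real \<Rightarrow> real \<Rightarrow> real"
  assumes s: "s > 3 / 2" and sol: "is_solution n s T u" and t: "t \<in> {0..<T}" and zero: "\<And>x. u t x = 0"
  shows "\<exists>\<delta>>0. \<forall>\<tau>\<in>{0..<T}. \<bar>\<tau> - t\<bar> < \<delta> \<longrightarrow> (\<forall>x. u \<tau> x = 0)"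
proof -
  note classical = is_solution_imp_classical[OF s sol]
  have ut: "u t = (\<lambda>x. 0)" using zero by auto
  obtain e where e: "e > 0" "\<And>\<tau> x. \<tau> \<in> {0..<T} \<Longrightarrow> \<tau> \<noteq> t \<Longrightarrow> dist \<tau> t < e \<Longrightarrow> \<bar>u \<tau> x\<bar> < 1 \<and> \<bar>deriv (u \<tau>) x\<bar> < 1"
    using classical(4)[OF t, of 1] unfolding eventually_at ut by auto
  have small: "\<bar>u \<tau> x\<bar> \<le> 1" "\<bar>deriv (u \<tau>) x\<bar> \<le> 1" if "\<tau> \<in> {0..<T}" "\<bar>\<tau> - t\<bar> < e" for \<tau> x
    using e(2)[of \<tau> x] that by (cases "\<tau> = t"; simp add: ut dist_real_def)+
  \<comment> \<open>The summand \<open>1\<close> keeps \<open>K\<close> positive, so that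
    \<open>1 / (2 * K)\<close> is an admissible step length. The other bound \<open>e\<close> on
    \<open>\<delta>\<close> keeps \<open>u\<close> and its spatial derivative at most
    \<open>1\<close>.\<close>
  define K where "K = real n + 2 * source_const n + 1"
  have K: "K > 0" "real n + 2 * source_const n \<le> K" using source_const_nonneg[of n] by (auto simp: K_def)
  define \<delta> where "\<delta> = min e (1 / (2 * K))"
  have joint: "continuous_on ({0..<T} \<times> UNIV) (\<lambda>p. u (fst p) (snd p))"
  proof (rule continuous_on_Times_of_uniform)
    show "continuous_on UNIV (u t)" if "t \<in> {0..<T}" for t
      using sol that by (simp add: is_solution_def)
    show "eventually (\<lambda>\<tau>. \<forall>x. \<bar>u \<tau> x - u t x\<bar> < e) (at t within {0..<T})" if "t \<in> {0..<T}" "e > 0" for t e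
      using classical(4)[OF that] by eventually_elim blast
  qed
  have "u \<tau> x = 0" if \<tau>: "\<tau> \<in> {0..<T}" "\<bar>\<tau> - t\<bar> < \<delta>" for \<tau> x
  proof -
    define \<sigma> l where "\<sigma> = (if t \<le> \<tau> then 1 else - 1 :: real)" and "l = \<bar>\<tau> - t\<bar>"
    have \<sigma>: "\<bar>\<sigma>\<bar> = 1" by (simp add: \<sigma>_def)
    have l: "0 \<le> l" "l < e" "l < 1 / (2 * K)" using \<tau> by (auto simp: l_def \<delta>_def)
    have shift: "t + \<sigma> * r \<in> {0..<T}" "\<bar>t + \<sigma> * r - t\<bar> < e" if "r \<in> {0..l}" for r
      using that t \<tau>(1) l(2) by (auto simp: \<sigma>_def l_def)
    have "u (t + \<sigma> * l) x = 0"
    proof (rule vanishing_persists[where u = "\<lambda>r. u (t + \<sigma> * r)" and d = l and n = n, OF \<sigma>])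
      show "continuous_on ({0..l} \<times> UNIV) (\<lambda>p. u (t + \<sigma> * fst p) (snd p))"
      proof -
        have "continuous_on ({0..l} \<times> UNIV) (\<lambda>p. (t + \<sigma> * fst p, snd p))"
          by (intro continuous_intros)
        moreover have "(\<lambda>p. (t + \<sigma> * fst p, snd p)) ` ({0..l} \<times> UNIV) \<subseteq> {0..<T} \<times> UNIV"
          using shift(1) by fastforce
        ultimately show ?thesis
          using continuous_on_compose2[OF joint, of "{0..l} \<times> UNIV" "\<lambda>p. (t + \<sigma> * fst p, snd p)"] by simp
      qed
      have "(real n + 2 * source_const n) * l \<le> K * (1 / (2 * K))"
        using K l source_const_nonneg[of n] by (intro mult_mono) auto
      then show "(real n + 2 * source_const n) * l \<le> 1 / 2" using K by simp
      show "l \<in> {0..l}" using l by simp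
      show "u (t + \<sigma> * 0) x = 0" for x using zero by simp
      fix r x assume r: "r \<in> {0..l}"
      show "(u (t + \<sigma> * r) has_real_derivative deriv (u (t + \<sigma> * r)) x) (at x)"
        by (rule classical(1)[OF shift(1)[OF r]])
      show "\<bar>u (t + \<sigma> * r) x\<bar> \<le> 1" "\<bar>deriv (u (t + \<sigma> * r)) x\<bar> \<le> 1"
        using small[OF shift[OF r]] by auto
      let ?D = "- (u (t + \<sigma> * r) x ^ n * deriv (u (t + \<sigma> * r)) x
          + deriv (inv_helmholtz (nonlocal_source n (u (t + \<sigma> * r)))) x)"
      have "((\<lambda>t. u t x) has_real_derivative ?D) (at (t + \<sigma> * r) within (\<lambda>r. t + \<sigma> * r) ` {0..l})"
        by (rule has_field_derivative_subset[OF classical(5)[OF shift(1)[OF r]]]) (use shift(1) in auto)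
      moreover have "((\<lambda>r. t + \<sigma> * r) has_real_derivative \<sigma>) (at r within {0..l})"
        by (auto intro!: derivative_eq_intros)
      ultimately have "((\<lambda>t. u t x) \<circ> (\<lambda>r. t + \<sigma> * r) has_real_derivative ?D * \<sigma>) (at r within {0..l})"
        by (rule DERIV_image_chain)
      then show "((\<lambda>r. u (t + \<sigma> * r) x) has_real_derivative \<sigma> * ?D) (at r within {0..l})"
        by (simp add: o_def mult.commute)
      show "continuous_on UNIV (deriv (u (t + \<sigma> * r)))"
        by (rule classical(2)[OF shift(1)[OF r]])
    qed
    moreover have "t + \<sigma> * l = \<tau>" by (auto simp: \<sigma>_def l_def)
    ultimately show ?thesis by simp
  qed
  moreover have "\<delta> > 0" using e(1) K by (simp add: \<delta>_def)
  ultimately show ?thesis by blast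
qed

theorem theorem2p5:
  fixes n :: nat and T s t0 t1 x0 x1 :: real and u :: "real \<Rightarrow> real \<Rightarrow> real"
  assumes "odd n" and "T > 0" and "s > 3/2"
    and "is_solution n s T u"
    and "t0 < t1" and "x0 < x1"
    and "{t0<..<t1} \<times> {x0<..<x1} \<subseteq> {0..<T} \<times> UNIV"
    and "\<forall>(t, x)\<in>{t0<..<t1} \<times> {x0<..<x1}. u t x = 0"
  shows "\<forall>t\<in>{0..<T}. \<forall>x. u t x = 0"
proof -
  define Z where "Z = {t \<in> {0..<T}. \<forall>x. u t x = 0}"
  have sub: "{t0<..<t1} \<subseteq> {0..<T}"
    using assms(6,7) by (auto simp: times_subset_iff)
  define t where "t = (t0 + t1) / 2"
  have t: "t \<in> {t0<..<t1}" using assms(5) by (auto simp: t_def)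
  have "u t x = 0" for x
    by (rule vanishes_at_rectangle_time[OF assms(1,3,4) t sub assms(6)]) (use assms(8) in auto)
  then have "t \<in> Z" using t sub by (auto simp: Z_def)
  moreover have "openin (top_of_set {0..<T}) Z"
    unfolding openin_contains_ball
  proof (intro conjI ballI)
    fix t assume "t \<in> Z"
    then obtain \<delta> where "\<delta> > 0" "\<forall>\<tau>\<in>{0..<T}. \<bar>\<tau> - t\<bar> < \<delta> \<longrightarrow> (\<forall>x. u \<tau> x = 0)"
      using vanishing_near[OF assms(3,4), of t] by (auto simp: Z_def)
    then show "\<exists>\<epsilon>>0. ball t \<epsilon> \<inter> {0..<T} \<subseteq> Z"
      by (intro exI[of _ \<delta>]) (auto simp: Z_def dist_real_def abs_minus_commute)
  qed (auto simp: Z_def)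
  moreover have "closedin (top_of_set {0..<T}) Z"
  proof -
    have "continuous_on {0..<T} (\<lambda>t. u t x)" for x
      by (rule DERIV_continuous_on[OF is_solution_imp_classical(5)[OF assms(3,4)]])
    then have "closedin (top_of_set {0..<T}) {t \<in> {0..<T}. u t x = 0}" for x
      by (rule continuous_closedin_preimage_constant)
    then have "closedin (top_of_set {0..<T}) (\<Inter>x. {t \<in> {0..<T}. u t x = 0})"
      by (intro closedin_INT) auto
    moreover have "(\<Inter>x. {t \<in> {0..<T}. u t x = 0}) = Z" by (auto simp: Z_def)
    ultimately show ?thesis by simp
  qed
  ultimately have "Z = {0..<T}"
    using convex_connected[OF convex_real_interval(7)[of 0 T]] unfolding connected_clopen by blast
  then show ?thesis by (auto simp: Z_def)
qed

end
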